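(* Let $p\geq 1$, $0<T<\infty$, $0<A<\infty$. Let $X=\{X(t),t\in\mathbb{R}\}$ be a measurable real-valued stationary Gaussian stochastic process with $\mathbf{E}X(t)=0$ and covariance function $\rho(\tau)=\mathbf{E}X(t+\tau)X(t)$, which is assumed continuous. Consider the correlogram \[ \hat\rho(\tau)=\frac{1}{T}\int_0^{T}X(t+\tau)X(t)\,dt,\qquad 0\leq\tau\leq A, \] as an estimator of $\rho(\tau)$, and let \[ C_p=\int_0^{A}\Bigl(\frac{2}{T^2}\int_0^{T}(T-u)\bigl(\rho^2(u)+\rho(u+\tau)\rho(u-\tau)\bigr)\,du\Bigr)^{p/2}d\tau, \] assumed positive. Then for all $\varepsilon\geq\bigl(\frac{p}{\sqrt2}+\sqrt{(\frac p2+1)p}\bigr)^{p}C_p$, \[ P\Bigl\{\int_0^{A}|\hat\rho(\tau)-\rho(\tau)|^p\,d\tau>\varepsilon\Bigr\}\leq 2\sqrt{1+\frac{\sqrt2\,\varepsilon^{1/p}}{C_p^{1/p}}}\;\exp\Bigl\{-\frac{\varepsilon^{1/p}}{\sqrt2\,C_p^{1/p}}\Bigr\}. \]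
   Context: The covariance function $\rho$ of a stationary process is even, so $\rho(u-\tau)$ is defined for all real arguments. *)

theory Defs
  imports "HOL-Probability.Probability"
begin

definition gaussian_rv :: "'a measure \<Rightarrow> ('a \<Rightarrow> real) \<Rightarrow> bool" where
  "gaussian_rv M Y \<longleftrightarrow> Y \<in> borel_measurable M \<and>
     ((\<exists>\<mu> \<sigma>. \<sigma> > 0 \<and> distributed M lborel Y (normal_density \<mu> \<sigma>)) \<or>
      (\<exists>c. AE \<omega> in M. Y \<omega> = c))"

definition gaussian_process :: "'a measure \<Rightarrow> (real \<Rightarrow> 'a \<Rightarrow> real) \<Rightarrow> bool" where
  "gaussian_process M X \<longleftrightarrow>
     (\<forall>I c. finite I \<longrightarrow> gaussian_rv M (\<lambda>\<omega>. \<Sum>t\<in>I. c t * X t \<omega>))"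

definition stationary_process :: "'a measure \<Rightarrow> (real \<Rightarrow> 'a \<Rightarrow> real) \<Rightarrow> bool" where
  "stationary_process M X \<longleftrightarrow>
     (\<forall>I h. finite I \<longrightarrow>
        distr M (PiM I (\<lambda>_. borel)) (\<lambda>\<omega>. \<lambda>t\<in>I. X (t + h) \<omega>) =
        distr M (PiM I (\<lambda>_. borel)) (\<lambda>\<omega>. \<lambda>t\<in>I. X t \<omega>))"

definition measurable_process :: "'a measure \<Rightarrow> (real \<Rightarrow> 'a \<Rightarrow> real) \<Rightarrow> bool" where
  "measurable_process M X \<longleftrightarrow> (\<lambda>(t, \<omega>). X t \<omega>) \<in> borel_measurable (lborel \<Otimes>\<^sub>M M)"

definition correlogram :: "real \<Rightarrow> (real \<Rightarrow> 'a \<Rightarrow> real) \<Rightarrow> real \<Rightarrow> 'a \<Rightarrow> real" where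
  "correlogram T X \<tau> \<omega> = (1 / T) * (\<integral>t\<in>{0..T}. X (t + \<tau>) \<omega> * X t \<omega> \<partial>lborel)"

definition C_const :: "real \<Rightarrow> real \<Rightarrow> real \<Rightarrow> (real \<Rightarrow> real) \<Rightarrow> real" where
  "C_const p T A \<rho> = (\<integral>\<tau>\<in>{0..A}.
      ((2 / T\<^sup>2) * (\<integral>u\<in>{0..T}. (T - u) * ((\<rho> u)\<^sup>2 + \<rho> (u + \<tau>) * \<rho> (u - \<tau>)) \<partial>lborel))
        powr (p / 2) \<partial>lborel)"

end

theory Submission
  imports Defs "HOL-Complex_Analysis.Complex_Analysis"
begin

text \<open>
  The correlogram is approximated in $L^1$ by quadratic forms
  $Q = \frac1n\sum_i X(t_i+\tau)X(t_i)$ of finitely many jointly Gaussian variables. Gram-Schmidt in the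
  Gaussian space and the spectral theorem turn $Q$ into $\sum_k c_k Y_k^2$ with independent standard normal
  $Y_k$, so that
  \[ E\, e^{t(Q - EQ)} = \prod_k (1-2tc_k)^{-1/2} e^{-tc_k} \le (1-s)^{-1/2} e^{-s/2}
     \qquad\mbox{if } 4t^2\sum_k c_k^2 \le s^2 < 1, \]
  and $2\sum_k c_k^2$ is a double sum over covariances that converges to the inner integral
  $\sigma^2(\tau)$ of $C_p$. By Fatou's lemma the bound passes to
  $\hat\rho(\tau)-\rho(\tau)$.
  For $\alpha \ge p$ the tangent inequality $e^{\alpha z} \ge e^\alpha(1+\frac\alpha p(z^p-1))$ with
  $z = |\hat\rho(\tau)-\rho(\tau)|/(x\sigma(\tau))$, $x^p=\varepsilon/C_p$, integrated against
  $\sigma^p(\tau)\,d\tau$, shows that the event forces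
  $\int_0^A \sigma^p e^{\alpha z}\,d\tau \ge e^\alpha C_p$; Markov's inequality gives the probability bound
  $2(1-s)^{-1/2}e^{-s/2-\alpha}$ with $\alpha = sx/\sqrt2$, which is smallest at
  $s=\sqrt2x/(1+\sqrt2x)$. The hypothesis on $\varepsilon$ is exactly $\alpha\ge p$.
\<close>

section \<open>Diagonalisation of symmetric matrices\<close>

text \<open>Joint normality is given through the one-dimensional laws of linear combinations, so the
  product formula for the exponential moment is derived from transforms: a weighted variable whose
  moment generating function is exp (t^2 / 2) up to a constant is standard normal under the weight.
  The paths of X are merely measurable, so Riemann sums need not converge path by path. Continuity
  of \<rho> at 0 means continuity of X in mean square, and with Fubini this gives convergence in
  L^1. The variance alone controls the product because (- ln (1 - x) - x) / x^2 is a power series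
  with positive coefficients: for a given sum of squares, a single eigenvalue is the worst case. The
  tangent is that of w \<mapsto> exp (\<alpha> w^(1/p)) at w = 1, the threshold z = 1 written in w =
  z^p; \<alpha> \<ge> p keeps it below the function down to w = 0. With the optimal s this condition
  reads x^2 - sqrt 2 p x - p \<ge> 0, whose larger root is the constant in the hypothesis on
  \<epsilon>. Where \<sigma>(\<tau>) = 0 the quotient z has no meaning; there the correlogram equals
  \<rho>(\<tau>) almost surely, and Fubini makes this usable for almost all \<tau> at once.\<close>

lemma orthonormal_projection_unit:
  fixes v :: "nat \<Rightarrow> nat \<Rightarrow> real"
  assumes "\<And>j l. j < k \<Longrightarrow> l < k \<Longrightarrow> (\<Sum>i<m. v j i * v l i) = (if j = l then 1 else 0)"
    and "a < m"
  defines "x \<equiv> \<lambda>i. (if i = a then 1 else 0) - (\<Sum>j<k. v j a * v j i)"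
  shows "(\<Sum>i<m. (x i)\<^sup>2) = 1 - (\<Sum>j<k. (v j a)\<^sup>2)"
    and "\<And>l. l < k \<Longrightarrow> (\<Sum>i<m. x i * v l i) = 0"
proof -
  show orth: "(\<Sum>i<m. x i * v l i) = 0" if l: "l < k" for l
  proof -
    have "(\<Sum>i<m. x i * v l i)
        = (\<Sum>i<m. (if i = a then v l i else 0)) - (\<Sum>i<m. \<Sum>j<k. v j a * (v j i * v l i))"
      unfolding x_def sum_subtractf[symmetric]
      by (intro sum.cong refl) (simp add: algebra_simps sum_distrib_left)
    also have "(\<Sum>i<m. \<Sum>j<k. v j a * (v j i * v l i)) = (\<Sum>j<k. v j a * (\<Sum>i<m. v j i * v l i))"
      by (subst sum.swap) (simp add: sum_distrib_left)
    also have "\<dots> = (\<Sum>j<k. if j = l then v j a else 0)"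
      using assms(1) l by (intro sum.cong refl) auto
    finally show ?thesis using l assms(2) by simp
  qed
  have "(x i)\<^sup>2 = (if i = a then x i else 0) - (\<Sum>j<k. v j a * (x i * v j i))" for i
  proof -
    have "(x i)\<^sup>2 = x i * ((if i = a then 1 else 0) - (\<Sum>j<k. v j a * v j i))"
      unfolding power2_eq_square by (simp add: x_def)
    then show ?thesis by (simp add: right_diff_distrib sum_distrib_left mult_ac)
  qed
  then have "(\<Sum>i<m. (x i)\<^sup>2) = (\<Sum>i<m. (if i = a then x i else 0)) - (\<Sum>i<m. \<Sum>j<k. v j a * (x i * v j i))"
    by (simp add: sum_subtractf)
  also have "(\<Sum>i<m. \<Sum>j<k. v j a * (x i * v j i)) = (\<Sum>j<k. v j a * (\<Sum>i<m. x i * v j i))"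
    by (subst sum.swap) (simp add: sum_distrib_left)
  also have "\<dots> = 0" using orth by simp
  also have "(\<Sum>i<m. (if i = a then x i else 0)) = x a"
    using assms(2) by simp
  also have "x a = 1 - (\<Sum>j<k. (v j a)\<^sup>2)"
    by (simp add: x_def power2_eq_square)
  finally show "(\<Sum>i<m. (x i)\<^sup>2) = 1 - (\<Sum>j<k. (v j a)\<^sup>2)" by simp
qed

text \<open>The squared projections of the m coordinate vectors onto the span of the v_j add up to k
  < m, so one of them is below 1 and that coordinate vector has a nonzero residual, which is
  normalised. The result is cut off beyond m so that it lies in the compact set over which the
  quadratic form is maximised later.\<close>

lemma orthonormal_extend:
  fixes v :: "nat \<Rightarrow> nat \<Rightarrow> real"
  assumes orth: "\<And>j l. j < k \<Longrightarrow> l < k \<Longrightarrow> (\<Sum>i<m. v j i * v l i) = (if j = l then 1 else 0)"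
    and "k < m"
  obtains x where "\<And>i. i \<ge> m \<Longrightarrow> x i = 0" "(\<Sum>i<m. (x i)\<^sup>2) = 1"
    "\<And>l. l < k \<Longrightarrow> (\<Sum>i<m. x i * v l i) = 0"
proof -
  have "(\<Sum>a<m. \<Sum>j<k. (v j a)\<^sup>2) = (\<Sum>j<k. \<Sum>a<m. v j a * v j a)"
    unfolding power2_eq_square by (rule sum.swap)
  also have "\<dots> = k" using orth by simp
  also have "\<dots> < (\<Sum>a<m. 1)" using \<open>k < m\<close> by simp
  finally have lt: "(\<Sum>a<m. \<Sum>j<k. (v j a)\<^sup>2) < (\<Sum>a<m. 1)" .
  have "\<not> (\<forall>a\<in>{..<m}. 1 \<le> (\<Sum>j<k. (v j a)\<^sup>2))"
  proof
    assume "\<forall>a\<in>{..<m}. 1 \<le> (\<Sum>j<k. (v j a)\<^sup>2)"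
    then have "(\<Sum>a<m. 1) \<le> (\<Sum>a<m. \<Sum>j<k. (v j a)\<^sup>2)" by (intro sum_mono) simp
    with lt show False by linarith
  qed
  then obtain a where a: "a < m" "(\<Sum>j<k. (v j a)\<^sup>2) < 1" by (auto simp: not_le)
  define x where "x = (\<lambda>i. (if i = a then 1 else 0) - (\<Sum>j<k. v j a * v j i))"
  define r where "r = sqrt (1 - (\<Sum>j<k. (v j a)\<^sup>2))"
  have r: "r > 0" "r\<^sup>2 = 1 - (\<Sum>j<k. (v j a)\<^sup>2)" using a by (auto simp: r_def)
  have p: "(\<Sum>i<m. (x i)\<^sup>2) = r\<^sup>2" "\<And>l. l < k \<Longrightarrow> (\<Sum>i<m. x i * v l i) = 0"
    using orthonormal_projection_unit[where k=k and m=m and v=v, OF orth a(1)] r(2) unfolding x_def by auto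
  show thesis
  proof (rule that[of "\<lambda>i. if i < m then x i / r else 0"])
    have "(\<Sum>i<m. (if i < m then x i / r else 0)\<^sup>2) = (\<Sum>i<m. (x i)\<^sup>2) / r\<^sup>2"
      unfolding sum_divide_distrib by (intro sum.cong) (auto simp: power_divide)
    then show "(\<Sum>i<m. (if i < m then x i / r else 0)\<^sup>2) = 1" using p(1) r(1) by simp
    fix l assume "l < k"
    have "(\<Sum>i<m. (if i < m then x i / r else 0) * v l i) = (\<Sum>i<m. x i * v l i) / r"
      unfolding sum_divide_distrib by (intro sum.cong) auto
    then show "(\<Sum>i<m. (if i < m then x i / r else 0) * v l i) = 0" using p(2)[OF \<open>l < k\<close>] by simp
  qed simp
qed

text \<open>With k = m the squared residuals of the coordinate vectors sum to m - m = 0. All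
  residuals therefore vanish, and entry b of residual a is the claimed relation between
  columns.\<close>

lemma orthonormal_complete:
  fixes v :: "nat \<Rightarrow> nat \<Rightarrow> real"
  assumes orth: "\<And>j l. j < m \<Longrightarrow> l < m \<Longrightarrow> (\<Sum>i<m. v j i * v l i) = (if j = l then 1 else 0)"
    and "a < m" "b < m"
  shows "(\<Sum>j<m. v j a * v j b) = (if a = b then 1 else 0)"
proof -
  define x where "x = (\<lambda>a i. (if i = a then 1 else 0) - (\<Sum>j<m. v j a * v j i))"
  have p: "(\<Sum>i<m. (x a i)\<^sup>2) = 1 - (\<Sum>j<m. (v j a)\<^sup>2)" if "a < m" for a
    using orthonormal_projection_unit(1)[where k=m and m=m and v=v, OF orth that] by (simp add: x_def)
  have "(\<Sum>a<m. \<Sum>i<m. (x a i)\<^sup>2) = (\<Sum>a<m. 1 - (\<Sum>j<m. (v j a)\<^sup>2))"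
    using p by (intro sum.cong) auto
  also have "\<dots> = m - (\<Sum>a<m. \<Sum>j<m. v j a * v j a)"
    by (simp add: sum_subtractf power2_eq_square)
  also have "(\<Sum>a<m. \<Sum>j<m. v j a * v j a) = (\<Sum>j<m. \<Sum>a<m. v j a * v j a)"
    by (rule sum.swap)
  also have "\<dots> = m" using orth by simp
  finally have "(\<Sum>i<m. (x a i)\<^sup>2) = 0"
    using \<open>a < m\<close> by (simp add: sum_nonneg_eq_0_iff sum_nonneg)
  then have "x a b = 0" using \<open>b < m\<close> by (simp add: sum_nonneg_eq_0_iff)
  then have "(\<Sum>j<m. v j a * v j b) = (if b = a then 1 else 0)" unfolding x_def by linarith
  then show ?thesis by (cases "a = b") simp_all
qed

text \<open>A maximiser of the quadratic form on the unit sphere of the orthogonal complement of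
  eigenvectors already found is again an eigenvector.\<close>

lemma symmetric_next_eigenvector:
  fixes B v :: "nat \<Rightarrow> nat \<Rightarrow> real"
  assumes sym: "\<And>i j. B i j = B j i"
    and orth: "\<And>j l. j < k \<Longrightarrow> l < k \<Longrightarrow> (\<Sum>i<m. v j i * v l i) = (if j = l then 1 else 0)"
    and eig: "\<And>j i. j < k \<Longrightarrow> i < m \<Longrightarrow> (\<Sum>a<m. B i a * v j a) = c j * v j i"
    and "k < m"
  obtains x M where "(\<Sum>i<m. (x i)\<^sup>2) = 1" "\<And>l. l < k \<Longrightarrow> (\<Sum>i<m. x i * v l i) = 0"
    "\<And>i. i < m \<Longrightarrow> (\<Sum>a<m. B i a * x a) = M * x i"
proof -
  define K where "K = {x::nat \<Rightarrow> real. (\<forall>i\<ge>m. x i = 0) \<and> (\<Sum>i<m. (x i)\<^sup>2) = 1 \<and>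
      (\<forall>l\<in>{..<k}. (\<Sum>i<m. x i * v l i) = 0)}"
  define q where "q = (\<lambda>x::nat \<Rightarrow> real. \<Sum>i<m. \<Sum>j<m. B i j * x i * x j)"
  have "K \<noteq> {}"
  proof (rule orthonormal_extend[where k=k and m=m and v=v, OF orth \<open>k < m\<close>])
    fix x :: "nat \<Rightarrow> real"
    assume "\<And>i. i \<ge> m \<Longrightarrow> x i = 0" "(\<Sum>i<m. (x i)\<^sup>2) = 1" "\<And>l. l < k \<Longrightarrow> (\<Sum>i<m. x i * v l i) = 0"
    then have "x \<in> K" by (simp add: K_def)
    then show ?thesis by blast
  qed
  have cont: "continuous_on UNIV (\<lambda>x::nat\<Rightarrow>real. x i)" for i by simp
  have clo: "closed {x::nat\<Rightarrow>real. f x = c}" if "continuous_on UNIV f" for f and c :: real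
    using that by (intro closed_Collect_eq continuous_on_const)
  have "compact K"
  proof -
    \<comment> \<open>Vectors are functions on all naturals, so boundedness is expressed by a
      product of compact intervals, with {0} for the coordinates from m on, and compactness comes
      from Tychonoff's theorem.\<close>
    define I where "I = (\<lambda>i. if i < m then {-1..1::real} else {0})"
    have "compactin (product_topology (\<lambda>i::nat. euclidean) UNIV) (PiE UNIV I)"
      by (subst compactin_PiE) (auto simp: I_def)
    then have 1: "compact (PiE UNIV I)" by (simp add: euclidean_product_topology)
    have "K = (\<Inter>i\<in>{m..}. {x. x i = 0}) \<inter> {x. (\<Sum>i<m. (x i)\<^sup>2) = 1}
        \<inter> (\<Inter>l\<in>{..<k}. {x. (\<Sum>i<m. x i * v l i) = 0})"
      by (auto simp: K_def)
    moreover have "continuous_on UNIV (\<lambda>x::nat\<Rightarrow>real. \<Sum>i<m. (x i)\<^sup>2)"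
      by (rule continuous_on_sum, rule continuous_on_power, rule cont)
    moreover have "continuous_on UNIV (\<lambda>x::nat\<Rightarrow>real. \<Sum>i<m. x i * v l i)" for l
      by (rule continuous_on_sum, rule continuous_on_mult_right, rule cont)
    ultimately have 2: "closed K"
      by (simp add: clo closed_Int closed_INT)
    have "K \<subseteq> PiE UNIV I"
    proof
      fix x assume x: "x \<in> K"
      have "x i \<in> I i" for i
      proof (cases "i < m")
        case True
        have "(x i)\<^sup>2 \<le> (\<Sum>i<m. (x i)\<^sup>2)" using True by (intro member_le_sum) auto
        also have "\<dots> = 1" using x by (simp add: K_def)
        finally have "\<bar>x i\<bar> \<le> 1" by (simp add: abs_square_le_1)
        then show ?thesis using True by (auto simp: I_def)
      next
        case False then show ?thesis using x by (auto simp: I_def K_def)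
      qed
      then show "x \<in> PiE UNIV I" by (simp add: PiE_UNIV_domain)
    qed
    then show ?thesis using 1 2 by (metis compact_Int_closed inf.absorb2 inf.commute)
  qed
  moreover have "continuous_on K q"
  proof -
    have "continuous_on UNIV q"
      unfolding q_def
      by (rule continuous_on_sum, rule continuous_on_sum, rule continuous_on_mult[OF continuous_on_mult_left[OF cont] cont])
    then show ?thesis by (rule continuous_on_subset) simp
  qed
  ultimately obtain x where x: "x \<in> K" "\<And>y. y \<in> K \<Longrightarrow> q y \<le> q x"
    using continuous_attains_sup[OF _ \<open>K \<noteq> {}\<close>, of q] by auto
  define M where "M = q x"
  \<comment> \<open>\<open>L\<close> applies M Id - B and \<open>R\<close> is the bilinear form of
    this operator. Maximality of M makes \<open>R\<close> nonnegative on the linear space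
    \<open>V\<close>, with value 0 at the maximiser; a null vector of a nonnegative form is
    orthogonal to everything.\<close>
  define L where "L = (\<lambda>(y::nat \<Rightarrow> real) i. M * y i - (\<Sum>j<m. B i j * y j))"
  define R where "R = (\<lambda>y z. \<Sum>i<m. L y i * z i)"
  have Rq: "R y y = M * (\<Sum>i<m. (y i)\<^sup>2) - q y" for y
    unfolding R_def L_def q_def sum_distrib_left sum_subtractf[symmetric]
    by (intro sum.cong refl) (simp add: algebra_simps sum_distrib_left power2_eq_square)
  define V where "V = {y::nat \<Rightarrow> real. (\<forall>i\<ge>m. y i = 0) \<and> (\<forall>l\<in>{..<k}. (\<Sum>i<m. y i * v l i) = 0)}"
  have Rnn: "R y y \<ge> 0" if y: "y \<in> V" for y
  proof (cases "(\<Sum>i<m. (y i)\<^sup>2) = 0")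
    case True
    then have "\<And>i. i < m \<Longrightarrow> y i = 0" by (simp add: sum_nonneg_eq_0_iff)
    then show ?thesis by (simp add: R_def)
  next
    case False
    define n where "n = sqrt (\<Sum>i<m. (y i)\<^sup>2)"
    have pos: "(\<Sum>i<m. (y i)\<^sup>2) > 0" using False sum_nonneg[of "{..<m}" "\<lambda>i. (y i)\<^sup>2"] by simp
    then have n: "n > 0" "n\<^sup>2 = (\<Sum>i<m. (y i)\<^sup>2)" by (auto simp: n_def)
    have "(\<lambda>i. y i / n) \<in> K"
      using y pos unfolding K_def V_def
      by (simp add: power_divide n(2)[symmetric] sum_divide_distrib[symmetric])
    from x(2)[OF this] have "q (\<lambda>i. y i / n) \<le> M" by (simp add: M_def)
    moreover have "q (\<lambda>i. y i / n) = q y / n\<^sup>2"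
      by (simp add: q_def power2_eq_square sum_divide_distrib)
    ultimately have "q y \<le> M * n\<^sup>2" using n(1) by (simp add: pos_divide_le_eq)
    then show ?thesis by (simp add: Rq n(2))
  qed
  have xV: "x \<in> V" using x by (auto simp: K_def V_def)
  have Rx: "R x x = 0" using x(1) unfolding Rq by (simp add: M_def K_def)
  have Rsym: "R y z = R z y" for y z
  proof -
    have "(\<Sum>i<m. \<Sum>j<m. B i j * y j * z i) = (\<Sum>i<m. \<Sum>j<m. B i j * z j * y i)"
      by (subst sum.swap) (intro sum.cong refl, subst sym, simp)
    then show ?thesis
      unfolding R_def L_def left_diff_distrib sum_subtractf sum_distrib_right by (simp add: mult_ac)
  qed
  have Ladd: "L (\<lambda>i. x i + s * y i) i = L x i + s * L y i" for s y i
    by (simp add: L_def algebra_simps sum.distrib sum_distrib_left)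
  have R0: "R x y = 0" if y: "y \<in> V" for y
  proof -
    have *: "2 * s * R x y + s\<^sup>2 * R y y \<ge> 0" for s
    proof -
      have "(\<lambda>i. x i + s * y i) \<in> V"
        using xV y by (auto simp: V_def algebra_simps sum.distrib sum_distrib_left[symmetric])
      from Rnn[OF this]
      have "0 \<le> R (\<lambda>i. x i + s * y i) (\<lambda>i. x i + s * y i)" .
      also have "\<dots> = R x x + s * R x y + s * R y x + s\<^sup>2 * R y y"
        unfolding R_def Ladd sum_distrib_left sum.distrib[symmetric]
        by (intro sum.cong refl) (simp add: algebra_simps power2_eq_square)
      finally show ?thesis using Rx Rsym[of y x] by simp
    qed
    show ?thesis
    proof (rule ccontr)
      assume nz: "R x y \<noteq> 0"
      \<comment> \<open>The minimiser of the quadratic in s would have \<open>R y y\<close> as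
        denominator, which may be 0; adding 1 keeps it positive and still gives a negative
        value.\<close>
      define D where "D = R y y + 1"
      have D: "D > 0" using Rnn[OF y] by (simp add: D_def)
      have "0 \<le> 2 * (- R x y / D) * R x y + (- R x y / D)\<^sup>2 * R y y" by (rule *)
      also have "\<dots> = ((R x y)\<^sup>2 / D) * (R y y / D - 2)"
        using D by (simp add: power2_eq_square field_simps)
      also have "\<dots> < 0"
      proof (rule mult_pos_neg)
        show "(R x y)\<^sup>2 / D > 0" using nz D by simp
        have "R y y < D" by (simp add: D_def)
        then have "R y y / D < 1" using D by simp
        then show "R y y / D - 2 < 0" by simp
      qed
      finally show False by simp
    qed
  qed
  \<comment> \<open>The residual (M Id - B) x itself belongs to \<open>V\<close>, because B maps the
    complement of its eigenvectors into itself. Testing against it turns \<open>R x g = 0\<close>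
    into a vanishing sum of squares.\<close>
  define g where "g = (\<lambda>i. if i < m then L x i else 0)"
  have gV: "g \<in> V"
  proof -
    have "(\<Sum>i<m. g i * v l i) = 0" if l: "l < k" for l
    proof -
      have "(\<Sum>i<m. g i * v l i) = M * (\<Sum>i<m. x i * v l i) - (\<Sum>i<m. \<Sum>a<m. B i a * x a * v l i)"
        unfolding g_def L_def sum_distrib_left sum_subtractf[symmetric]
        by (intro sum.cong refl) (simp add: left_diff_distrib sum_distrib_right)
      also have "(\<Sum>i<m. \<Sum>a<m. B i a * x a * v l i) = (\<Sum>a<m. x a * (\<Sum>i<m. B a i * v l i))"
        unfolding sum_distrib_left
        by (subst sum.swap) (intro sum.cong refl, subst sym, simp)
      also have "\<dots> = (\<Sum>a<m. c l * (x a * v l a))"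
        using eig[OF l] by (intro sum.cong) auto
      also have "\<dots> = c l * (\<Sum>a<m. x a * v l a)" by (simp add: sum_distrib_left)
      finally show ?thesis using x(1) l by (simp add: K_def)
    qed
    then show ?thesis by (auto simp: V_def g_def)
  qed
  have "(\<Sum>i<m. (g i)\<^sup>2) = R x g"
    unfolding R_def by (intro sum.cong) (auto simp: g_def power2_eq_square)
  also have "\<dots> = 0" using R0[OF gV] .
  finally have "g i = 0" if "i < m" for i using that by (simp add: sum_nonneg_eq_0_iff)
  then have "(\<Sum>a<m. B i a * x a) = M * x i" if "i < m" for i using that by (simp add: g_def L_def)
  then show thesis using x(1) by (intro that) (auto simp: K_def)
qed

text \<open>Eigenvectors can be added one at a time until k = m. Then completeness of the columns
  turns the eigenvector equations into the expansion of the entries of B.\<close>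

theorem symmetric_spectral:
  fixes B :: "nat \<Rightarrow> nat \<Rightarrow> real"
  assumes sym: "\<And>i j. B i j = B j i"
  obtains v c where
    "\<And>k l. k < m \<Longrightarrow> l < m \<Longrightarrow> (\<Sum>i<m. v k i * v l i) = (if k = l then 1 else 0)"
    "\<And>i j. i < m \<Longrightarrow> j < m \<Longrightarrow> B i j = (\<Sum>k<m. c k * v k i * v k j)"
proof -
  have "\<exists>v c. (\<forall>j<k. \<forall>l<k. (\<Sum>i<m. v j i * v l i) = (if j = l then 1 else 0)) \<and>
      (\<forall>j<k. \<forall>i<m. (\<Sum>a<m. B i a * v j a) = c j * v j i)" if "k \<le> m" for k
    using that
  proof (induction k)
    case 0 show ?case by simp
  next
    case (Suc k)
    then have "k \<le> m" and km: "k < m" by simp_all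
    from Suc.IH[OF this(1)] obtain v c where
      vc: "\<forall>j<k. \<forall>l<k. (\<Sum>i<m. v j i * v l i) = (if j = l then 1 else 0)"
      "\<forall>j<k. \<forall>i<m. (\<Sum>a<m. B i a * v j a) = c j * v j i" by (elim exE conjE)
    obtain x M where x: "(\<Sum>i<m. (x i)\<^sup>2) = 1" "\<And>l. l < k \<Longrightarrow> (\<Sum>i<m. x i * v l i) = 0"
      "\<And>i. i < m \<Longrightarrow> (\<Sum>a<m. B i a * x a) = M * x i"
      by (rule symmetric_next_eigenvector[where B=B and k=k and m=m and v=v and c=c,
            OF sym vc(1)[rule_format] vc(2)[rule_format] km]) (assumption+, rule that)
    have "\<And>l. l < k \<Longrightarrow> (\<Sum>i<m. v l i * x i) = 0" using x(2) by (simp add: mult.commute)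
    then have "\<forall>j<Suc k. \<forall>l<Suc k. (\<Sum>i<m. (v(k := x)) j i * (v(k := x)) l i) = (if j = l then 1 else 0)"
      using vc(1) x(1,2) by (auto simp: less_Suc_eq power2_eq_square)
    moreover have "\<forall>j<Suc k. \<forall>i<m. (\<Sum>a<m. B i a * (v(k := x)) j a) = (c(k := M)) j * (v(k := x)) j i"
      using vc(2) x(3) by (auto simp: less_Suc_eq)
    ultimately show ?case by blast
  qed
  from this[OF order_refl] obtain v c where
    vc: "\<forall>j<m. \<forall>l<m. (\<Sum>i<m. v j i * v l i) = (if j = l then 1 else 0)"
    "\<forall>j<m. \<forall>i<m. (\<Sum>a<m. B i a * v j a) = c j * v j i" by (elim exE conjE)
  note o = vc(1)[rule_format] and e = vc(2)[rule_format]
  note comp = orthonormal_complete[OF o]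
  have "B i j = (\<Sum>k<m. c k * v k i * v k j)" if "i < m" "j < m" for i j
  proof -
    have "(\<Sum>k<m. c k * v k i * v k j) = (\<Sum>k<m. (\<Sum>a<m. B i a * v k a) * v k j)"
      using e that by (intro sum.cong) auto
    also have "\<dots> = (\<Sum>a<m. B i a * (\<Sum>k<m. v k a * v k j))"
      unfolding sum_distrib_left sum_distrib_right by (subst sum.swap) (simp add: mult_ac)
    also have "\<dots> = (\<Sum>a<m. if a = j then B i a else 0)"
      using comp that by (intro sum.cong) auto
    also have "\<dots> = B i j" using that by simp
    finally show ?thesis by simp
  qed
  with o show thesis by (rule that)
qed

text \<open>For a quadratic form in orthonormal Gaussian variables the trace is the mean, the
  squared Frobenius norm is half the variance, and the third identity is the form in rotated
  coordinates.\<close>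

lemma spectral_trace:
  fixes B v :: "nat \<Rightarrow> nat \<Rightarrow> real"
  assumes v: "\<And>k l. k < m \<Longrightarrow> l < m \<Longrightarrow> (\<Sum>i<m. v k i * v l i) = (if k = l then 1 else 0)"
    and B: "\<And>i j. i < m \<Longrightarrow> j < m \<Longrightarrow> B i j = (\<Sum>k<m. c k * v k i * v k j)"
  shows "(\<Sum>i<m. B i i) = (\<Sum>k<m. c k)"
    and "(\<Sum>i<m. \<Sum>j<m. (B i j)\<^sup>2) = (\<Sum>k<m. (c k)\<^sup>2)"
    and "(\<Sum>i<m. \<Sum>j<m. B i j * y i * y j) = (\<Sum>k<m. c k * (\<Sum>i<m. v k i * y i)\<^sup>2)"
proof -
  have "(\<Sum>i<m. B i i) = (\<Sum>i<m. \<Sum>k<m. c k * (v k i * v k i))"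
    using B by (intro sum.cong) (auto simp: mult.assoc)
  also have "\<dots> = (\<Sum>k<m. c k * (\<Sum>i<m. v k i * v k i))"
    unfolding sum_distrib_left by (rule sum.swap)
  also have "\<dots> = (\<Sum>k<m. c k)" using v by (intro sum.cong) auto
  finally show "(\<Sum>i<m. B i i) = (\<Sum>k<m. c k)" .
  \<comment> \<open>Arbitrary weights, since the identity serves twice:
    \<open>f i j = y i * y j\<close> yields the quadratic form and \<open>f = B\<close> the
    Frobenius norm.\<close>
  have quad: "(\<Sum>i<m. \<Sum>j<m. B i j * f i j) = (\<Sum>k<m. c k * (\<Sum>i<m. \<Sum>j<m. v k i * v k j * f i j))"
    for f :: "nat \<Rightarrow> nat \<Rightarrow> real"
  proof -
    have "(\<Sum>i<m. \<Sum>j<m. B i j * f i j) = (\<Sum>i<m. \<Sum>j<m. \<Sum>k<m. c k * (v k i * v k j * f i j))"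
      using B by (intro sum.cong refl) (auto simp: sum_distrib_right mult.assoc)
    also have "\<dots> = (\<Sum>i<m. \<Sum>k<m. \<Sum>j<m. c k * (v k i * v k j * f i j))"
      by (rule sum.cong[OF refl], rule sum.swap)
    also have "\<dots> = (\<Sum>k<m. \<Sum>i<m. \<Sum>j<m. c k * (v k i * v k j * f i j))" by (rule sum.swap)
    finally show ?thesis by (simp add: sum_distrib_left)
  qed
  show "(\<Sum>i<m. \<Sum>j<m. B i j * y i * y j) = (\<Sum>k<m. c k * (\<Sum>i<m. v k i * y i)\<^sup>2)"
    using quad[of "\<lambda>i j. y i * y j"] by (simp add: power2_eq_square sum_product mult_ac)
  have "(\<Sum>j<m. B i j * v k j) = c k * v k i" if "k < m" "i < m" for i k
  proof -
    have "(\<Sum>j<m. B i j * v k j) = (\<Sum>j<m. \<Sum>l<m. c l * v l i * (v l j * v k j))"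
      using B that by (intro sum.cong refl) (auto simp: sum_distrib_right mult.assoc)
    also have "\<dots> = (\<Sum>l<m. c l * v l i * (\<Sum>j<m. v l j * v k j))"
      unfolding sum_distrib_left by (rule sum.swap)
    also have "\<dots> = (\<Sum>l<m. if l = k then c k * v k i else 0)"
      using v that by (intro sum.cong) auto
    finally show ?thesis using that by simp
  qed
  then have "(\<Sum>i<m. \<Sum>j<m. v k i * v k j * B i j) = c k" if "k < m" for k
  proof -
    have "(\<Sum>i<m. \<Sum>j<m. v k i * v k j * B i j) = (\<Sum>i<m. v k i * (\<Sum>j<m. B i j * v k j))"
      by (simp add: sum_distrib_left mult_ac)
    also have "\<dots> = (\<Sum>i<m. c k * (v k i * v k i))"
      using \<open>\<And>k i. k < m \<Longrightarrow> i < m \<Longrightarrow> (\<Sum>j<m. B i j * v k j) = c k * v k i\<close> that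
      by (intro sum.cong) auto
    finally show ?thesis using v that by (simp add: sum_distrib_left[symmetric])
  qed
  then show "(\<Sum>i<m. \<Sum>j<m. (B i j)\<^sup>2) = (\<Sum>k<m. (c k)\<^sup>2)"
    using quad[of B] by (simp add: power2_eq_square)
qed

text \<open>This is where the shape of the inner integrand of C_p originates. If a_i and b_i are the
  coordinates of X(t_i + \<tau>) and X(t_i), the dot products are covariances; the first product
  becomes \<rho>(u)^2 and the second \<rho>(u + \<tau>) \<rho>(u - \<tau>) with u = t_i - t_j. The
  four terms of the expanded square agree in pairs under exchange of k and l, hence the factor
  2.\<close>

lemma symmetrized_product_norm:
  fixes a b :: "'i \<Rightarrow> nat \<Rightarrow> real"
  assumes "finite I"
  shows "(\<Sum>k<m. \<Sum>l<m. (\<Sum>i\<in>I. a i k * b i l + a i l * b i k)\<^sup>2)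
    = 2 * (\<Sum>i\<in>I. \<Sum>j\<in>I. (\<Sum>k<m. a i k * a j k) * (\<Sum>k<m. b i k * b j k)
        + (\<Sum>k<m. a i k * b j k) * (\<Sum>k<m. b i k * a j k))"
proof -
  let ?f = "\<lambda>i k l. a i k * b i l + a i l * b i k"
  have "(\<Sum>k<m. \<Sum>l<m. (\<Sum>i\<in>I. ?f i k l)\<^sup>2) = (\<Sum>z\<in>{..<m}\<times>{..<m}. (\<Sum>i\<in>I. ?f i (fst z) (snd z))\<^sup>2)"
    by (simp add: sum.cartesian_product case_prod_beta)
  also have "\<dots> = (\<Sum>z\<in>{..<m}\<times>{..<m}. \<Sum>i\<in>I. \<Sum>j\<in>I. ?f i (fst z) (snd z) * ?f j (fst z) (snd z))"
    by (simp add: power2_eq_square sum_product)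
  also have "\<dots> = (\<Sum>i\<in>I. \<Sum>z\<in>{..<m}\<times>{..<m}. \<Sum>j\<in>I. ?f i (fst z) (snd z) * ?f j (fst z) (snd z))"
    by (rule sum.swap)
  also have "\<dots> = (\<Sum>i\<in>I. \<Sum>j\<in>I. \<Sum>z\<in>{..<m}\<times>{..<m}. ?f i (fst z) (snd z) * ?f j (fst z) (snd z))"
    by (rule sum.cong[OF refl], rule sum.swap)
  also have "\<dots> = (\<Sum>i\<in>I. \<Sum>j\<in>I. \<Sum>k<m. \<Sum>l<m. ?f i k l * ?f j k l)"
    by (simp add: sum.cartesian_product case_prod_beta)
  also have "\<dots> = (\<Sum>i\<in>I. \<Sum>j\<in>I. 2 * ((\<Sum>k<m. a i k * a j k) * (\<Sum>k<m. b i k * b j k)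
        + (\<Sum>k<m. a i k * b j k) * (\<Sum>k<m. b i k * a j k)))"
  proof (intro sum.cong refl)
    fix i j
    have "(\<Sum>k<m. \<Sum>l<m. ?f i k l * ?f j k l)
        = (\<Sum>k<m. \<Sum>l<m. (a i k * a j k) * (b i l * b j l))
        + (\<Sum>k<m. \<Sum>l<m. (a i k * b j k) * (b i l * a j l))
        + (\<Sum>k<m. \<Sum>l<m. (b i k * a j k) * (a i l * b j l))
        + (\<Sum>k<m. \<Sum>l<m. (b i k * b j k) * (a i l * a j l))"
      unfolding sum.distrib[symmetric] by (intro sum.cong refl) (simp add: algebra_simps)
    then show "(\<Sum>k<m. \<Sum>l<m. ?f i k l * ?f j k l) = 2 * ((\<Sum>k<m. a i k * a j k) * (\<Sum>k<m. b i k * b j k)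
        + (\<Sum>k<m. a i k * b j k) * (\<Sum>k<m. b i k * a j k))"
      unfolding sum_product[symmetric] by simp
  qed
  finally show ?thesis by (simp add: sum_distrib_left)
qed

section \<open>Products of chi-square transforms\<close>

lemma minus_ln_one_minus_sums:
  fixes x :: real
  assumes "\<bar>x\<bar> < 1"
  shows "(\<lambda>n. x ^ (n + 1) / (n + 1)) sums (- ln (1 - x))"
proof -
  have "summable (\<lambda>n. \<bar>x\<bar> * \<bar>x\<bar> ^ n)"
    using assms by (intro summable_mult summable_geometric) simp
  moreover have "norm (x ^ (n + 1) / (n + 1)) \<le> \<bar>x\<bar> * \<bar>x\<bar> ^ n" for n
  proof -
    have "norm (x ^ (n + 1) / (n + 1)) = (\<bar>x\<bar> * \<bar>x\<bar> ^ n) / (n + 1)"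
      by (simp add: power_abs abs_mult)
    also have "\<dots> \<le> (\<bar>x\<bar> * \<bar>x\<bar> ^ n) / 1" by (rule divide_left_mono) auto
    finally show ?thesis by simp
  qed
  ultimately have summ: "summable (\<lambda>n. x ^ (n + 1) / (n + 1))"
    by (rule summable_comparison_test'[where N = 0])
  have "ln (1 - x) = (\<Sum>n. (-1) ^ n * (1 / real (n + 1)) * ((1 - x) - 1) ^ Suc n)"
    using assms by (intro ln_series) auto
  also have "\<dots> = (\<Sum>n. - (x ^ (n + 1) / (n + 1)))"
  proof (rule suminf_cong)
    fix n :: nat
    have "(-1) ^ n * (1 / real (n + 1)) * ((1 - x) - 1) ^ Suc n = ((-1) ^ n * (- x) ^ n) * (- x) / (n + 1)"
      by simp
    also have "(-1) ^ n * (- x) ^ n = x ^ n" by (simp flip: power_mult_distrib)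
    finally show "(-1) ^ n * (1 / real (n + 1)) * ((1 - x) - 1) ^ Suc n = - (x ^ (n + 1) / (n + 1))"
      by simp
  qed
  also have "\<dots> = - (\<Sum>n. x ^ (n + 1) / (n + 1))" by (rule suminf_minus[OF summ])
  finally show ?thesis using summable_sums[OF summ] by simp
qed

text \<open>Both sides carry the factor x^2 s^2; what remains is the series of x^n / (n + 2) against
  that of s^n / (n + 2), compared termwise. The form without division includes x = 0 and s =
  0.\<close>

lemma minus_ln_quadratic_mono:
  fixes x s :: real
  assumes "\<bar>x\<bar> \<le> s" "s < 1"
  shows "s\<^sup>2 * (- ln (1 - x) - x) \<le> x\<^sup>2 * (- ln (1 - s) - s)"
proof -
  have s0: "0 \<le> s" using assms by linarith
  have sx: "(\<lambda>n. x ^ (n + 1) / (n + 1)) sums (- ln (1 - x))"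
    by (rule minus_ln_one_minus_sums) (use assms in linarith)
  have ss: "(\<lambda>n. s ^ (n + 1) / (n + 1)) sums (- ln (1 - s))"
    by (rule minus_ln_one_minus_sums) (use assms in linarith)
  have sx': "(\<lambda>n. s\<^sup>2 * (x ^ (n + 2) / (n + 2))) sums (s\<^sup>2 * (- ln (1 - x) - x))"
    using sums_split_initial_segment[OF sx, of 1]
    by (intro sums_mult) (simp add: add.commute)
  have ss': "(\<lambda>n. x\<^sup>2 * (s ^ (n + 2) / (n + 2))) sums (x\<^sup>2 * (- ln (1 - s) - s))"
    using sums_split_initial_segment[OF ss, of 1]
    by (intro sums_mult) (simp add: add.commute)
  show ?thesis
  proof (rule sums_le[OF _ sx' ss'])
    fix n :: nat
    have "x ^ n \<le> s ^ n"
    proof -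
      have "x ^ n \<le> \<bar>x\<bar> ^ n" by (metis abs_ge_self power_abs)
      also have "\<dots> \<le> s ^ n" using assms by (intro power_mono) auto
      finally show ?thesis .
    qed
    then have "s\<^sup>2 * x\<^sup>2 * x ^ n / (n + 2) \<le> s\<^sup>2 * x\<^sup>2 * s ^ n / (n + 2)"
      by (intro divide_right_mono mult_left_mono) auto
    then show "s\<^sup>2 * (x ^ (n + 2) / (n + 2)) \<le> x\<^sup>2 * (s ^ (n + 2) / (n + 2))"
      by (simp add: power_add power2_eq_square mult_ac)
  qed
qed

text \<open>The left side is the power -1/2 of the Carleman determinant, the product of the (1 -
  x_k) exp (x_k). For h x = - ln (1 - x) - x the preceding lemma gives h (x_k) \<le> (x_k / s)^2 h
  s, and summation over k leaves at most h s.\<close>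

lemma carleman_product_bound:
  fixes x :: "nat \<Rightarrow> real"
  assumes "(\<Sum>k<m. (x k)\<^sup>2) \<le> s\<^sup>2" "0 \<le> s" "s < 1"
  shows "(\<Prod>k<m. (1 - x k) powr (- 1 / 2)) * exp (- (\<Sum>k<m. x k) / 2) \<le> (1 - s) powr (- 1 / 2) * exp (- s / 2)"
proof -
  have xs: "\<bar>x k\<bar> \<le> s" if "k < m" for k
  proof -
    have "(x k)\<^sup>2 \<le> (\<Sum>k<m. (x k)\<^sup>2)" using that by (intro member_le_sum) auto
    then have "(x k)\<^sup>2 \<le> s\<^sup>2" using assms(1) by linarith
    then show ?thesis using assms(2) by (metis abs_le_square_iff abs_of_nonneg)
  qed
  define h where "h = (\<lambda>x::real. - ln (1 - x) - x)"
  have hs: "h s \<ge> 0" using ln_le_minus_one[of "1 - s"] assms by (simp add: h_def)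
  have "(\<Sum>k<m. h (x k)) \<le> h s"
  proof (cases "s = 0")
    case True
    then have "x k = 0" if "k < m" for k using xs[OF that] by simp
    then show ?thesis using True by (simp add: h_def)
  next
    case False
    then have s: "s > 0" using assms by simp
    have "s\<^sup>2 * (\<Sum>k<m. h (x k)) \<le> (\<Sum>k<m. (x k)\<^sup>2 * h s)"
      unfolding sum_distrib_left h_def
      by (intro sum_mono minus_ln_quadratic_mono) (use xs assms in auto)
    also have "\<dots> \<le> s\<^sup>2 * h s"
      unfolding sum_distrib_right[symmetric] by (rule mult_right_mono[OF assms(1) hs])
    finally show ?thesis using s by simp
  qed
  moreover have "(1 - y) powr (- 1 / 2) * exp (- y / 2) = exp (h y / 2)" if "y < 1" for y
    using that by (simp add: powr_def h_def exp_add[symmetric] field_simps)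
  moreover have "x k < 1" if "k < m" for k using xs[OF that] assms by linarith
  ultimately have eq: "(\<Prod>k<m. (1 - x k) powr (- 1 / 2) * exp (- x k / 2)) = exp ((\<Sum>k<m. h (x k)) / 2)"
    by (simp add: exp_sum sum_divide_distrib)
  have "(\<Prod>k<m. (1 - x k) powr (- 1 / 2)) * exp (- (\<Sum>k<m. x k) / 2)
      = (\<Prod>k<m. (1 - x k) powr (- 1 / 2) * exp (- x k / 2))"
    by (simp add: prod.distrib exp_sum[symmetric] sum_divide_distrib sum_negf)
  also have "\<dots> \<le> exp (h s / 2)" unfolding eq using \<open>(\<Sum>k<m. h (x k)) \<le> h s\<close> by simp
  also have "\<dots> = (1 - s) powr (- 1 / 2) * exp (- s / 2)"
    using \<open>\<And>y. y < 1 \<Longrightarrow> _ y = _\<close>[of s] assms by simp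
  finally show ?thesis .
qed

section \<open>Normal laws and their moment generating functions\<close>

text \<open>Exponential moments of both signs dominate all partial sums, through exp (|z| |x|) \<le>
  exp (|z| x) + exp (- |z| x), so the exponential series is integrated term by term. The expansion
  makes the transform an entire function.\<close>

lemma complex_mgf_sums:
  fixes N :: "real measure" and z :: complex
  assumes "sets N = sets borel"
    and int: "\<And>t. integrable N (\<lambda>x. exp (t * x))"
  shows "(\<lambda>n. (complex_of_real (\<integral>x. x ^ n \<partial>N) / fact n) * z ^ n) sums (\<integral>x. exp (z * of_real x) \<partial>N)"
proof -
  note [measurable_cong] = assms(1)
  let ?f = "\<lambda>n x. (z * complex_of_real x) ^ n /\<^sub>R fact n"
  have int2: "integrable N (\<lambda>x. exp (cmod z * \<bar>x\<bar>))"
  proof (rule Bochner_Integration.integrable_bound[OF Bochner_Integration.integrable_add[OF int[of "cmod z"] int[of "- cmod z"]]])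
    show "AE x in N. norm (exp (cmod z * \<bar>x\<bar>)) \<le> norm (exp (cmod z * x) + exp (- cmod z * x))"
    proof (intro AE_I2)
      fix x
      have "exp (cmod z * \<bar>x\<bar>) \<le> exp (cmod z * x) + exp (- cmod z * x)" by (auto simp: abs_if)
      then show "norm (exp (cmod z * \<bar>x\<bar>)) \<le> norm (exp (cmod z * x) + exp (- cmod z * x))"
        unfolding real_norm_def abs_exp_cancel by (rule order_trans[OF _ abs_ge_self])
    qed
  qed simp
  have nf: "norm (?f n x) = (cmod z * \<bar>x\<bar>) ^ n /\<^sub>R fact n" for n x
    by (simp add: norm_power norm_mult power_mult_distrib)
  have bd: "(\<Sum>n<k. norm (?f n x)) \<le> exp (cmod z * \<bar>x\<bar>)" for k x
    unfolding nf exp_def by (intro sum_le_suminf summable_exp_generic) auto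
  have bd1: "norm (?f n x) \<le> exp (cmod z * \<bar>x\<bar>)" for n x
  proof -
    have "norm (?f n x) \<le> (\<Sum>n<Suc n. norm (?f n x))" by (intro member_le_sum) auto
    then show ?thesis using bd[where k="Suc n" and x=x] by linarith
  qed
  have intf: "integrable N (?f n)" for n
    by (rule Bochner_Integration.integrable_bound[OF int2]) (use bd1[of n] in \<open>auto intro!: AE_I2\<close>)
  have sf: "summable (\<lambda>n. norm (?f n x))" for x
    unfolding nf by (rule summable_exp_generic)
  have si: "summable (\<lambda>n. \<integral>x. norm (?f n x) \<partial>N)"
  proof (rule summableI_nonneg_bounded)
    fix k
    have "(\<Sum>n<k. \<integral>x. norm (?f n x) \<partial>N) = (\<integral>x. (\<Sum>n<k. norm (?f n x)) \<partial>N)"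
      by (rule Bochner_Integration.integral_sum[symmetric]) (rule integrable_norm[OF intf])
    also have "\<dots> \<le> (\<integral>x. exp (cmod z * \<bar>x\<bar>) \<partial>N)"
      by (rule integral_mono[OF Bochner_Integration.integrable_sum[OF integrable_norm[OF intf]] int2 bd])
    finally show "(\<Sum>n<k. \<integral>x. norm (?f n x) \<partial>N) \<le> (\<integral>x. exp (cmod z * \<bar>x\<bar>) \<partial>N)" .
  qed simp
  have "(\<lambda>n. \<integral>x. ?f n x \<partial>N) sums (\<integral>x. (\<Sum>n. ?f n x) \<partial>N)"
    by (rule sums_integral[OF intf _ si]) (use sf in auto)
  moreover have "(\<integral>x. ?f n x \<partial>N) = (complex_of_real (\<integral>x. x ^ n \<partial>N) / fact n) * z ^ n" for n
  proof -
    have "(\<integral>x. ?f n x \<partial>N) = (\<integral>x. (z ^ n / fact n) * complex_of_real (x ^ n) \<partial>N)"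
      by (intro Bochner_Integration.integral_cong refl)
        (simp add: power_mult_distrib scaleR_conv_of_real field_simps)
    also have "\<dots> = (z ^ n / fact n) * complex_of_real (\<integral>x. x ^ n \<partial>N)"
      by (subst integral_mult_right_zero) (simp only: integral_complex_of_real)
    finally show ?thesis by (simp add: mult.commute)
  qed
  ultimately show ?thesis by (simp add: exp_def)
qed

text \<open>The transform is entire and agrees with exp (z^2 / 2) on the real line, hence everywhere
  by the identity theorem. On the imaginary axis it is the characteristic function, which determines
  the law.\<close>

lemma std_normal_distribution_of_mgf:
  fixes N :: "real measure"
  assumes N: "real_distribution N"
    and mgf: "\<And>t. (\<integral>\<^sup>+x. ennreal (exp (t * x)) \<partial>N) = ennreal (exp (t\<^sup>2 / 2))"
  shows "N = std_normal_distribution"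
proof (rule Levy_uniqueness[OF N real_dist_normal_dist], rule ext)
  interpret N: real_distribution N by fact
  have sets: "sets N = sets borel" by simp
  have int: "integrable N (\<lambda>x. exp (t * x))" for t
    by (rule integrableI_nonneg) (auto simp: mgf)
  have val: "(\<integral>x. exp (t * x) \<partial>N) = exp (t\<^sup>2 / 2)" for t
    by (subst integral_eq_nn_integral) (auto simp: mgf)
  define f where "f = (\<lambda>z::complex. \<integral>x. exp (z * of_real x) \<partial>N)"
  have holo: "f holomorphic_on UNIV"
  proof (rule holomorphic_on_subset[where s = "\<Union>r\<in>{0<..}. ball 0 r"])
    have "f holomorphic_on ball 0 r" for r
    proof (rule power_series_holomorphic)
      fix w :: complex assume "w \<in> ball 0 r"
      show "(\<lambda>n. (complex_of_real (\<integral>x. x ^ n \<partial>N) / fact n) * (w - 0) ^ n) sums f w"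
        using complex_mgf_sums[OF sets int, of w] by (simp add: f_def)
    qed
    then show "f holomorphic_on (\<Union>r\<in>{0<..}. ball 0 r)"
      by (intro holomorphic_on_UN_open) auto
    show "UNIV \<subseteq> (\<Union>r\<in>{0<..}. ball (0::complex) r)"
    proof
      fix x :: complex show "x \<in> (\<Union>r\<in>{0<..}. ball 0 r)"
        by (intro UN_I[of "cmod x + 1"]) (auto simp: add_nonneg_pos)
    qed
  qed
  have eq: "f z - exp (z\<^sup>2 / 2) = 0" for z
  proof (rule analytic_continuation[of "\<lambda>z. f z - exp (z\<^sup>2 / 2)" UNIV "\<real>" 0])
    show "(\<lambda>z. f z - exp (z\<^sup>2 / 2)) holomorphic_on UNIV"
      by (intro holomorphic_intros holo) auto
    show "(0::complex) islimpt \<real>"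
      unfolding islimpt_approachable
    proof (intro allI impI)
      fix e :: real assume "e > 0"
      then show "\<exists>x'\<in>\<real>. x' \<noteq> 0 \<and> dist x' (0::complex) < e"
        by (intro bexI[of _ "of_real (e / 2)"]) auto
    qed
    fix z :: complex assume "z \<in> \<real>"
    then obtain t where t: "z = of_real t" by (auto elim: Reals_cases)
    have "f z = (\<integral>x. complex_of_real (exp (t * x)) \<partial>N)"
      unfolding f_def t by (simp add: exp_of_real[symmetric])
    also have "\<dots> = complex_of_real (exp (t\<^sup>2 / 2))"
      unfolding integral_complex_of_real val ..
    also have "\<dots> = exp (z\<^sup>2 / 2)"
      by (simp only: t exp_of_real[symmetric] of_real_power of_real_divide of_real_numeral)
    finally show "f z - exp (z\<^sup>2 / 2) = 0" by simp
  qed auto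
  fix t
  have "char N t = f (\<i> * t)"
    by (simp add: char_def f_def mult.assoc)
  also have "\<dots> = exp ((\<i> * of_real t)\<^sup>2 / 2)" using eq[of "\<i> * t"] by simp
  also have "\<dots> = char std_normal_distribution t"
    by (simp add: char_std_normal_distribution power_mult_distrib exp_of_real[symmetric])
  finally show "char N t = char std_normal_distribution t" .
qed

text \<open>Under the measure with density w / K the variable Y has the standard normal transform,
  hence the standard normal law. Later w carries the factors of the other variables, and the
  conclusion says that the factor depending on Y splits off as it would under independence.\<close>

lemma weighted_std_normal:
  fixes Y :: "'a \<Rightarrow> real" and w :: "'a \<Rightarrow> ennreal"
  assumes [measurable]: "Y \<in> borel_measurable M" "w \<in> borel_measurable M" "f \<in> borel_measurable borel"
    and "K > 0"
    and mgf: "\<And>t. (\<integral>\<^sup>+\<omega>. w \<omega> * ennreal (exp (t * Y \<omega>)) \<partial>M) = ennreal (K * exp (t\<^sup>2 / 2))"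
  shows "(\<integral>\<^sup>+\<omega>. w \<omega> * f (Y \<omega>) \<partial>M) = ennreal K * (\<integral>\<^sup>+x. f x \<partial>std_normal_distribution)"
proof -
  define N where "N = distr (density M (\<lambda>\<omega>. w \<omega> * ennreal (1 / K))) borel Y"
  have *: "(\<integral>\<^sup>+x. g x \<partial>N) = (\<integral>\<^sup>+\<omega>. w \<omega> * g (Y \<omega>) \<partial>M) * ennreal (1 / K)"
    if [measurable]: "g \<in> borel_measurable borel" for g
    unfolding N_def
    by (subst nn_integral_distr, simp, simp, subst nn_integral_density, simp, simp)
      (simp_all add: nn_integral_cmult[symmetric] mult_ac)
  have mgfN: "(\<integral>\<^sup>+x. ennreal (exp (t * x)) \<partial>N) = ennreal (exp (t\<^sup>2 / 2))" for t
    by (subst *) (use \<open>K > 0\<close> in \<open>auto simp: mgf ennreal_mult[symmetric]\<close>)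
  \<comment> \<open>The transform at t = 0 is the total mass, so K is the right
    normalisation.\<close>
  have "emeasure N (space N) = (\<integral>\<^sup>+x. ennreal (exp (0 * x)) \<partial>N)" by simp
  also have "\<dots> = 1" by (subst mgfN) simp
  finally have "prob_space N" by (rule prob_spaceI)
  then have "real_distribution N"
    by (auto simp: real_distribution_def real_distribution_axioms_def N_def)
  from std_normal_distribution_of_mgf[OF this mgfN] have N: "N = std_normal_distribution" .
  have "(\<integral>\<^sup>+\<omega>. w \<omega> * f (Y \<omega>) \<partial>M) = (\<integral>\<^sup>+\<omega>. w \<omega> * f (Y \<omega>) \<partial>M) * ennreal (1 / K) * ennreal K"
    using \<open>K > 0\<close> by (simp add: mult.assoc ennreal_mult[symmetric])
  also have "\<dots> = (\<integral>\<^sup>+x. f x \<partial>N) * ennreal K" by (simp add: *)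
  finally show ?thesis unfolding N by (simp add: mult.commute)
qed

text \<open>The integrand against Lebesgue measure is a multiple of the centred normal density of
  variance 1 / (1 - \<mu>), and the multiple is the square root of that variance.\<close>

lemma nn_integral_std_normal_exp_square:
  assumes "\<mu> < 1"
  shows "(\<integral>\<^sup>+x. ennreal (exp (\<mu> * x\<^sup>2 / 2)) \<partial>std_normal_distribution) = ennreal ((1 - \<mu>) powr (- 1 / 2))"
proof -
  define s where "s = 1 / sqrt (1 - \<mu>)"
  have s: "s > 0" "s\<^sup>2 = 1 / (1 - \<mu>)" using assms by (auto simp: s_def power_divide)
  have eq: "std_normal_density x * exp (\<mu> * x\<^sup>2 / 2) = s * normal_density 0 s x" for x
  proof -
    have "s * normal_density 0 s x = s / sqrt (2 * pi * s\<^sup>2) * exp (- (x - 0)\<^sup>2 / (2 * s\<^sup>2))"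
      by (simp add: normal_density_def)
    also have "sqrt (2 * pi * s\<^sup>2) = sqrt (2 * pi) * s" using s(1) by (simp add: real_sqrt_mult)
    also have "s / (sqrt (2 * pi) * s) = 1 / sqrt (2 * pi)" using s by simp
    also have "- (x - 0)\<^sup>2 / (2 * s\<^sup>2) = - x\<^sup>2 / 2 + \<mu> * x\<^sup>2 / 2"
      using assms by (simp add: s(2) field_simps)
    finally show ?thesis unfolding std_normal_density_def exp_add by (simp add: mult_ac)
  qed
  interpret n: prob_space "density lborel (normal_density 0 s)" by (rule prob_space_normal_density[OF s(1)])
  have n1: "(\<integral>\<^sup>+x. ennreal (normal_density 0 s x) \<partial>lborel) = 1"
    using n.emeasure_space_1 by (simp add: emeasure_density)
  have "(\<integral>\<^sup>+x. ennreal (exp (\<mu> * x\<^sup>2 / 2)) \<partial>std_normal_distribution)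
      = (\<integral>\<^sup>+x. ennreal s * ennreal (normal_density 0 s x) \<partial>lborel)"
    using s by (subst nn_integral_density) (auto simp: ennreal_mult[symmetric] eq)
  also have "\<dots> = ennreal s" by (simp add: nn_integral_cmult n1)
  also have "s = (1 - \<mu>) powr (- 1 / 2)"
    using assms by (simp add: s_def powr_minus powr_half_sqrt field_simps)
  finally show ?thesis .
qed

section \<open>Gaussian spaces\<close>

text \<open>Joint normality is encoded by closure under linear combinations together with
  one-dimensional normality. Since \<open>gaussian_rv\<close> admits almost surely constant
  variables, singular covariance matrices are covered.\<close>

locale gaussian_space = prob_space M for M :: "'a measure" +
  fixes G :: "('a \<Rightarrow> real) set"
  assumes gauss: "Z \<in> G \<Longrightarrow> gaussian_rv M Z"
    and centred: "Z \<in> G \<Longrightarrow> expectation Z = 0"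
    and zero: "(\<lambda>_. 0) \<in> G"
    and add: "Y \<in> G \<Longrightarrow> Z \<in> G \<Longrightarrow> (\<lambda>\<omega>. Y \<omega> + Z \<omega>) \<in> G"
    and scale: "Z \<in> G \<Longrightarrow> (\<lambda>\<omega>. c * Z \<omega>) \<in> G"
begin

abbreviation cov :: "('a \<Rightarrow> real) \<Rightarrow> ('a \<Rightarrow> real) \<Rightarrow> real" where
  "cov Y Z \<equiv> expectation (\<lambda>\<omega>. Y \<omega> * Z \<omega>)"

lemma measurable_G: "Z \<in> G \<Longrightarrow> Z \<in> borel_measurable M"
  using gauss by (auto simp: gaussian_rv_def)

lemma G_cases:
  assumes "Z \<in> G"
  obtains \<sigma> where "\<sigma> > 0" "distributed M lborel Z (normal_density 0 \<sigma>)" | "AE \<omega> in M. Z \<omega> = 0"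
proof -
  note [measurable] = measurable_G[OF assms]
  consider \<mu> \<sigma> where "\<sigma> > 0" "distributed M lborel Z (normal_density \<mu> \<sigma>)"
    | c where "AE \<omega> in M. Z \<omega> = c"
    using gauss[OF assms] unfolding gaussian_rv_def by blast
  then show thesis
  proof cases
    case 1
    then have "\<mu> = 0" using normal_distributed_expectation[of \<sigma> Z \<mu>] centred[OF assms] by simp
    then show ?thesis using 1 that(1) by simp
  next
    case 2
    then have "expectation Z = expectation (\<lambda>_. c)" by (intro integral_cong_AE) auto
    then have "c = 0" using centred[OF assms] by (simp add: prob_space)
    then show ?thesis using 2 that(2) by simp
  qed
qed

lemma square_integrable:
  assumes "Z \<in> G"
  shows "integrable M (\<lambda>\<omega>. (Z \<omega>)\<^sup>2)"
  using assms
proof (cases rule: G_cases)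
  case (1 \<sigma>)
  have "integrable lborel (\<lambda>x. normal_density 0 \<sigma> x * x\<^sup>2)"
    using integrable_normal_moment[of \<sigma> 0 2] 1 by simp
  then show ?thesis
    using distributed_integrable[OF 1(2), of "\<lambda>x. x\<^sup>2"] by simp
next
  case 2
  note [measurable] = measurable_G[OF assms]
  from 2 have "integrable M (\<lambda>\<omega>. (Z \<omega>)\<^sup>2) \<longleftrightarrow> integrable M (\<lambda>\<omega>. 0::real)"
    by (intro integrable_cong_AE) auto
  then show ?thesis by simp
qed

text \<open>Tilting the centred normal density of variance \<sigma>^2 by exp x shifts its mean to
  \<sigma>^2 and produces the factor exp (\<sigma>^2 / 2). A degenerate Z gives 1 on both
  sides.\<close>

lemma nn_integral_exp:
  assumes "Z \<in> G"
  shows "(\<integral>\<^sup>+\<omega>. ennreal (exp (Z \<omega>)) \<partial>M) = ennreal (exp (cov Z Z / 2))"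
  using assms
proof (cases rule: G_cases)
  case (1 \<sigma>)
  have v: "cov Z Z = \<sigma>\<^sup>2"
    using normal_distributed_variance[OF 1] centred[OF assms] by (simp add: power2_eq_square)
  interpret n: prob_space "density lborel (normal_density (\<sigma>\<^sup>2) \<sigma>)"
    by (rule prob_space_normal_density[OF 1(1)])
  have n1: "(\<integral>\<^sup>+x. ennreal (normal_density (\<sigma>\<^sup>2) \<sigma> x) \<partial>lborel) = 1"
    using n.emeasure_space_1 by (simp add: emeasure_density)
  have eq: "normal_density 0 \<sigma> x * exp x = exp (\<sigma>\<^sup>2 / 2) * normal_density (\<sigma>\<^sup>2) \<sigma> x" for x
  proof -
    have "- (x - 0)\<^sup>2 / (2 * \<sigma>\<^sup>2) + x = \<sigma>\<^sup>2 / 2 + - (x - \<sigma>\<^sup>2)\<^sup>2 / (2 * \<sigma>\<^sup>2)"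
      using 1(1) by (simp add: field_simps power2_eq_square)
    then have "exp (- (x - 0)\<^sup>2 / (2 * \<sigma>\<^sup>2)) * exp x = exp (\<sigma>\<^sup>2 / 2) * exp (- (x - \<sigma>\<^sup>2)\<^sup>2 / (2 * \<sigma>\<^sup>2))"
      by (metis exp_add)
    then show ?thesis unfolding normal_density_def by simp
  qed
  have "(\<integral>\<^sup>+\<omega>. ennreal (exp (Z \<omega>)) \<partial>M)
      = (\<integral>\<^sup>+x. ennreal (normal_density 0 \<sigma> x) * ennreal (exp x) \<partial>lborel)"
    by (rule distributed_nn_integral[OF 1(2), symmetric]) simp
  also have "\<dots> = (\<integral>\<^sup>+x. ennreal (exp (\<sigma>\<^sup>2 / 2)) * ennreal (normal_density (\<sigma>\<^sup>2) \<sigma> x) \<partial>lborel)"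
    by (simp add: ennreal_mult[symmetric] eq)
  also have "\<dots> = ennreal (exp (\<sigma>\<^sup>2 / 2))" by (simp add: nn_integral_cmult n1)
  finally show ?thesis using v by simp
next
  case 2
  note [measurable] = measurable_G[OF assms]
  have "(\<integral>\<^sup>+\<omega>. ennreal (exp (Z \<omega>)) \<partial>M) = (\<integral>\<^sup>+\<omega>. 1 \<partial>M)"
    by (rule nn_integral_cong_AE) (use 2 in auto)
  moreover have "cov Z Z = expectation (\<lambda>_. 0)"
    by (rule integral_cong_AE) (use 2 in auto)
  ultimately show ?thesis by (simp add: emeasure_space_1)
qed

text \<open>Polarisation: the product is a combination of the squares of Y + Z, Y and Z, all of
  which belong to the space.\<close>

lemma prod_integrable:
  assumes "Y \<in> G" "Z \<in> G"
  shows "integrable M (\<lambda>\<omega>. Y \<omega> * Z \<omega>)"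
proof -
  have "integrable M (\<lambda>\<omega>. ((Y \<omega> + Z \<omega>)\<^sup>2 - (Y \<omega>)\<^sup>2 - (Z \<omega>)\<^sup>2) / 2)"
    using square_integrable[OF add[OF assms]] square_integrable[OF assms(1)] square_integrable[OF assms(2)]
    by auto
  then show ?thesis by (simp add: power2_eq_square algebra_simps)
qed

lemma sum_closed: "finite I \<Longrightarrow> (\<And>i. i \<in> I \<Longrightarrow> Z i \<in> G) \<Longrightarrow> (\<lambda>\<omega>. \<Sum>i\<in>I. c i * Z i \<omega>) \<in> G"
  by (induction I rule: finite_induct) (simp_all add: zero add[OF scale])

lemma cov_sum_right:
  assumes "Y \<in> G" "\<And>i. i \<in> I \<Longrightarrow> Z i \<in> G"
  shows "cov Y (\<lambda>\<omega>. \<Sum>i\<in>I. c i * Z i \<omega>) = (\<Sum>i\<in>I. c i * cov Y (Z i))"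
proof -
  have "cov Y (\<lambda>\<omega>. \<Sum>i\<in>I. c i * Z i \<omega>) = expectation (\<lambda>\<omega>. \<Sum>i\<in>I. c i * (Y \<omega> * Z i \<omega>))"
    by (simp add: sum_distrib_left mult_ac)
  also have "\<dots> = (\<Sum>i\<in>I. expectation (\<lambda>\<omega>. c i * (Y \<omega> * Z i \<omega>)))"
    by (rule Bochner_Integration.integral_sum) (use prod_integrable assms in auto)
  finally show ?thesis by simp
qed

lemma cov_commute: "cov Y Z = cov Z Y"
  by (simp add: mult.commute)

lemma cov_cong_AE:
  assumes "Y \<in> G" "Z \<in> G" "Z' \<in> G" "AE \<omega> in M. Z \<omega> = Z' \<omega>"
  shows "cov Y Z = cov Y Z'"
  by (rule integral_cong_AE) (use assms measurable_G in auto)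

section \<open>Orthonormal systems in a Gaussian space and their joint transforms\<close>

definition orthonormal :: "nat \<Rightarrow> (nat \<Rightarrow> 'a \<Rightarrow> real) \<Rightarrow> bool" where
  "orthonormal m Y \<longleftrightarrow> (\<forall>k<m. Y k \<in> G) \<and> (\<forall>k<m. \<forall>l<m. cov (Y k) (Y l) = (if k = l then 1 else 0))"

text \<open>The coefficients are covariances with the orthonormal system, so covariances of members
  of F become dot products of coefficient vectors. Repeated or linearly dependent members are
  allowed.\<close>

lemma gram_schmidt:
  assumes "finite F" "F \<subseteq> G"
  shows "\<exists>m Y. orthonormal m Y \<and> (\<forall>Z\<in>F. AE \<omega> in M. Z \<omega> = (\<Sum>k<m. cov Z (Y k) * Y k \<omega>))"
  using assms
proof (induction F rule: finite_induct)
  case empty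
  then show ?case by (intro exI[of _ 0]) (auto simp: orthonormal_def)
next
  case (insert Z F)
  then obtain m Y where Y: "orthonormal m Y"
    and F: "\<forall>Z\<in>F. AE \<omega> in M. Z \<omega> = (\<Sum>k<m. cov Z (Y k) * Y k \<omega>)" by auto
  have ZG: "Z \<in> G" and FG: "F \<subseteq> G" using insert.prems by auto
  have YG: "Y k \<in> G" if "k < m" for k using Y that by (auto simp: orthonormal_def)
  define P where "P = (\<lambda>\<omega>. \<Sum>k<m. cov Z (Y k) * Y k \<omega>)"
  define R where "R = (\<lambda>\<omega>. Z \<omega> + (-1) * P \<omega>)"
  have PG: "P \<in> G" unfolding P_def by (rule sum_closed) (use YG in auto)
  have RG: "R \<in> G" unfolding R_def by (rule add[OF ZG scale[OF PG]])
  have RY: "cov (Y l) R = 0" if l: "l < m" for l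
  proof -
    have "cov (Y l) P = (\<Sum>k<m. cov Z (Y k) * cov (Y l) (Y k))"
      unfolding P_def by (rule cov_sum_right) (use YG l in auto)
    also have "\<dots> = (\<Sum>k<m. if k = l then cov Z (Y k) else 0)"
      by (rule sum.cong) (use Y l in \<open>auto simp: orthonormal_def\<close>)
    also have "\<dots> = cov Z (Y l)" using l by simp
    finally have 1: "cov (Y l) P = cov (Y l) Z" by (simp add: mult.commute)
    have "cov (Y l) R = expectation (\<lambda>\<omega>. Y l \<omega> * Z \<omega> - Y l \<omega> * P \<omega>)"
      by (simp add: R_def algebra_simps)
    also have "\<dots> = cov (Y l) Z - cov (Y l) P"
      by (rule Bochner_Integration.integral_diff) (use prod_integrable YG[OF l] ZG PG in auto)
    finally show ?thesis using 1 by simp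
  qed
  note [measurable] = measurable_G[OF RG]
  have sqnn: "cov R R \<ge> 0" by (rule Bochner_Integration.integral_nonneg) simp
  show ?case
  proof (cases "cov R R = 0")
    case True
    \<comment> \<open>A residual of variance zero vanishes only almost surely; such a member adds no
      new vector to the system, and the expansion is accordingly an almost sure one.\<close>
    have "AE \<omega> in M. R \<omega> * R \<omega> = 0"
      using True integral_nonneg_eq_0_iff_AE[OF prod_integrable[OF RG RG]] by simp
    then have "AE \<omega> in M. Z \<omega> = P \<omega>" by eventually_elim (simp add: R_def)
    then show ?thesis using Y F unfolding P_def by blast
  next
    case False
    define r where "r = sqrt (cov R R)"
    have r: "r > 0" "r\<^sup>2 = cov R R" using False sqnn unfolding r_def by (simp_all add: less_le)
    define Y' where "Y' = Y(m := (\<lambda>\<omega>. (1 / r) * R \<omega>))"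
    have Y'm: "Y' m = (\<lambda>\<omega>. (1 / r) * R \<omega>)" and Y'k: "\<And>k. k < m \<Longrightarrow> Y' k = Y k"
      by (auto simp: Y'_def)
    have covY'm: "cov U (Y' m) = cov U R / r" for U
      by (simp add: Y'm mult.left_commute[of _ "1 / r"])
    have orth: "orthonormal (Suc m) Y'"
    proof -
      have "cov (Y' m) R = cov R R / r" using covY'm[of R] by (simp add: mult.commute)
      then have "cov (Y' m) (Y' m) = cov R R / r / r" using covY'm[of "Y' m"] by simp
      then have "cov (Y' m) (Y' m) = 1"
        unfolding r(2)[symmetric] using r(1) by (simp add: power2_eq_square)
      moreover have "cov (Y' k) (Y' m) = 0" if "k < m" for k
        using RY[OF that] by (simp add: covY'm Y'k that)
      moreover have "cov (Y' m) (Y' k) = 0" if "k < m" for k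
        using calculation(2)[OF that] by (simp add: mult.commute)
      moreover have "Y' m \<in> G" unfolding Y'm by (rule scale[OF RG])
      ultimately show ?thesis
        using Y unfolding orthonormal_def by (auto simp: less_Suc_eq Y'k)
    qed
    \<comment> \<open>Members already expanded lie in the span of the old system, to which the
      residual is orthogonal; their expansions gain a term with coefficient 0.\<close>
    have "cov U (Y' m) = 0" if "U \<in> F" for U
    proof -
      have UG: "U \<in> G" using that FG by auto
      have "cov R U = cov R (\<lambda>\<omega>. \<Sum>k<m. cov U (Y k) * Y k \<omega>)"
        by (rule cov_cong_AE[OF RG UG sum_closed]) (use YG F that in auto)
      also have "\<dots> = (\<Sum>k<m. cov U (Y k) * cov R (Y k))"
        by (rule cov_sum_right) (use RG YG in auto)
      also have "\<dots> = 0" using RY by (simp add: mult.commute)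
      finally have "cov U R = 0" by (simp add: mult.commute)
      then show ?thesis by (simp add: covY'm)
    qed
    then have 1: "AE \<omega> in M. U \<omega> = (\<Sum>k<Suc m. cov U (Y' k) * Y' k \<omega>)" if "U \<in> F" for U
      using F that by (simp add: Y'k)
    have "cov R P = (\<Sum>k<m. cov Z (Y k) * cov R (Y k))"
      unfolding P_def by (rule cov_sum_right) (use RG YG in auto)
    also have "\<dots> = 0" using RY by (simp add: mult.commute)
    finally have "cov R P = 0" .
    moreover have "cov R R = expectation (\<lambda>\<omega>. R \<omega> * Z \<omega> - R \<omega> * P \<omega>)"
      by (simp add: R_def algebra_simps)
    moreover have "\<dots> = cov R Z - cov R P"
      by (rule Bochner_Integration.integral_diff) (use prod_integrable RG ZG PG in auto)
    \<comment> \<open>Because R = Z - P is orthogonal to P, the coefficient of Z along R / r is r,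
      and r times R / r restores the residual.\<close>
    ultimately have "cov Z R = r\<^sup>2" using r by (simp add: mult.commute)
    then have "cov Z (Y' m) = r" using r(1) by (simp add: covY'm power2_eq_square)
    then have "Z \<omega> = (\<Sum>k<Suc m. cov Z (Y' k) * Y' k \<omega>)" for \<omega>
      using r(1) by (simp add: Y'k) (simp add: Y'm R_def P_def)
    then show ?thesis using orth 1 by blast
  qed
qed

text \<open>The combination is Gaussian and its variance is the sum of the squared coefficients, so
  the joint transform factorises. It is the base case for integrating out squares one by
  one.\<close>

lemma orthonormal_mgf:
  assumes "orthonormal m Y" "K \<subseteq> {..<m}"
  shows "(\<integral>\<^sup>+\<omega>. ennreal (exp (\<Sum>k\<in>K. c k * Y k \<omega>)) \<partial>M) = ennreal (exp ((\<Sum>k\<in>K. (c k)\<^sup>2) / 2))"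
proof -
  have fin: "finite K" using assms(2) finite_subset by blast
  have YG: "Y k \<in> G" if "k \<in> K" for k using assms that by (auto simp: orthonormal_def)
  let ?S = "\<lambda>\<omega>. \<Sum>k\<in>K. c k * Y k \<omega>"
  have S: "?S \<in> G" by (rule sum_closed[OF fin YG])
  have "cov ?S (Y l) = c l" if l: "l \<in> K" for l
  proof -
    have "cov ?S (Y l) = cov (Y l) ?S" by (rule cov_commute)
    also have "\<dots> = (\<Sum>k\<in>K. c k * cov (Y l) (Y k))"
      by (rule cov_sum_right) (use YG l in auto)
    also have "\<dots> = (\<Sum>k\<in>K. if k = l then c k else 0)"
      by (rule sum.cong) (use assms l in \<open>auto simp: orthonormal_def subset_iff\<close>)
    finally show ?thesis using l fin by simp
  qed
  moreover have "cov ?S ?S = (\<Sum>l\<in>K. c l * cov ?S (Y l))"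
    by (rule cov_sum_right[OF S YG])
  ultimately have "cov ?S ?S = (\<Sum>k\<in>K. (c k)\<^sup>2)"
    by (simp add: power2_eq_square cong: sum.cong)
  with nn_integral_exp[OF S] show ?thesis by simp
qed

text \<open>Independence of the $Y_k$ is not available from uncorrelatedness; instead the squares are
  integrated out one at a time, the remaining exponentials acting as a weight.\<close>

lemma orthonormal_exp_squares:
  assumes Y: "orthonormal m Y" and \<mu>: "\<And>k. k < m \<Longrightarrow> \<mu> k < 1"
  shows "(\<integral>\<^sup>+\<omega>. ennreal (exp (\<Sum>k<m. \<mu> k * (Y k \<omega>)\<^sup>2 / 2)) \<partial>M) = ennreal (\<Prod>k<m. (1 - \<mu> k) powr (- 1 / 2))"
proof -
  have YG: "Y k \<in> G" if "k < m" for k using assms that by (auto simp: orthonormal_def)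
  \<comment> \<open>The first j variables enter through squares, the others through an exponential.
    The coefficients \<open>c\<close> stay arbitrary because the step uses the hypothesis for every
    possible coefficient of \<open>Y j\<close>.\<close>
  have "(\<integral>\<^sup>+\<omega>. ennreal (exp (\<Sum>k<j. \<mu> k * (Y k \<omega>)\<^sup>2 / 2)) * ennreal (exp (\<Sum>k\<in>{j..<m}. c k * Y k \<omega>)) \<partial>M)
      = ennreal ((\<Prod>k<j. (1 - \<mu> k) powr (- 1 / 2)) * exp ((\<Sum>k\<in>{j..<m}. (c k)\<^sup>2) / 2))" if "j \<le> m" for j c
    using that
  proof (induction j arbitrary: c)
    case 0
    have "{0..<m} \<subseteq> {..<m}" by auto
    from orthonormal_mgf[OF Y this, of c] show ?case by simp
  next
    case (Suc j)
    then have j: "j < m" by simp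
    have [measurable]: "Y k \<in> borel_measurable M" if "k < m" for k using measurable_G[OF YG[OF that]] .
    define w where "w = (\<lambda>\<omega>. ennreal (exp (\<Sum>k<j. \<mu> k * (Y k \<omega>)\<^sup>2 / 2)) * ennreal (exp (\<Sum>k\<in>{Suc j..<m}. c k * Y k \<omega>)))"
    define K where "K = (\<Prod>k<j. (1 - \<mu> k) powr (- 1 / 2)) * exp ((\<Sum>k\<in>{Suc j..<m}. (c k)\<^sup>2) / 2)"
    have "0 < (1 - \<mu> a) powr (- 1 / 2)" if "a \<in> {..<j}" for a
      using \<mu>[of a] that j by simp
    then have Kpos: "K > 0" unfolding K_def by (intro mult_pos_pos prod_pos) simp_all
    have [measurable]: "(\<lambda>\<omega>. \<Sum>k<j. \<mu> k * (Y k \<omega>)\<^sup>2 / 2) \<in> borel_measurable M"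
      "(\<lambda>\<omega>. \<Sum>k\<in>{Suc j..<m}. c k * Y k \<omega>) \<in> borel_measurable M"
      using j by (intro borel_measurable_sum; auto)+
    have w: "w \<in> borel_measurable M" unfolding w_def by measurable
    \<comment> \<open>Inserting t as the coefficient of \<open>Y j\<close> into the induction
      hypothesis gives the transform of \<open>Y j\<close> under the weight \<open>w\<close>; it is
      K times that of a standard normal variable.\<close>
    have mgf: "(\<integral>\<^sup>+\<omega>. w \<omega> * ennreal (exp (t * Y j \<omega>)) \<partial>M) = ennreal (K * exp (t\<^sup>2 / 2))" for t
    proof -
      have ins: "{j..<m} = insert j {Suc j..<m}" using j by auto
      have s: "(\<Sum>k\<in>{j..<m}. g ((c(j := t)) k) k) = g t j + (\<Sum>k\<in>{Suc j..<m}. g (c k) k)"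
        for g :: "real \<Rightarrow> nat \<Rightarrow> real"
      proof -
        have "(\<Sum>k\<in>{Suc j..<m}. g ((c(j := t)) k) k) = (\<Sum>k\<in>{Suc j..<m}. g (c k) k)"
          by (rule sum.cong) auto
        then show ?thesis unfolding ins by simp
      qed
      have "(\<integral>\<^sup>+\<omega>. w \<omega> * ennreal (exp (t * Y j \<omega>)) \<partial>M)
          = (\<integral>\<^sup>+\<omega>. ennreal (exp (\<Sum>k<j. \<mu> k * (Y k \<omega>)\<^sup>2 / 2)) * ennreal (exp (\<Sum>k\<in>{j..<m}. (c(j := t)) k * Y k \<omega>)) \<partial>M)"
      proof (rule nn_integral_cong)
        fix \<omega>
        have "(\<Sum>k\<in>{j..<m}. (c(j := t)) k * Y k \<omega>) = t * Y j \<omega> + (\<Sum>k\<in>{Suc j..<m}. c k * Y k \<omega>)"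
          using s[of "\<lambda>a k. a * Y k \<omega>"] .
        then show "w \<omega> * ennreal (exp (t * Y j \<omega>)) = ennreal (exp (\<Sum>k<j. \<mu> k * (Y k \<omega>)\<^sup>2 / 2)) * ennreal (exp (\<Sum>k\<in>{j..<m}. (c(j := t)) k * Y k \<omega>))"
          unfolding w_def by (simp add: ennreal_mult[symmetric] exp_add mult_ac)
      qed
      also have "\<dots> = ennreal ((\<Prod>k<j. (1 - \<mu> k) powr (- 1 / 2)) * exp ((\<Sum>k\<in>{j..<m}. ((c(j := t)) k)\<^sup>2) / 2))"
        using Suc.IH[of "c(j := t)"] j by simp
      also have "(\<Sum>k\<in>{j..<m}. ((c(j := t)) k)\<^sup>2) = t\<^sup>2 + (\<Sum>k\<in>{Suc j..<m}. (c k)\<^sup>2)"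
        using s[of "\<lambda>a k. a\<^sup>2"] .
      finally show ?thesis by (simp add: K_def add_divide_distrib exp_add mult_ac)
    qed
    have "(\<integral>\<^sup>+\<omega>. w \<omega> * ennreal (exp (\<mu> j * (Y j \<omega>)\<^sup>2 / 2)) \<partial>M)
        = ennreal K * ennreal ((1 - \<mu> j) powr (- 1 / 2))"
      unfolding nn_integral_std_normal_exp_square[OF \<mu>[OF j], symmetric]
      by (rule weighted_std_normal[OF _ w _ Kpos mgf]) (use j in auto)
    moreover have "w \<omega> * ennreal (exp (\<mu> j * (Y j \<omega>)\<^sup>2 / 2))
        = ennreal (exp (\<Sum>k<Suc j. \<mu> k * (Y k \<omega>)\<^sup>2 / 2)) * ennreal (exp (\<Sum>k\<in>{Suc j..<m}. c k * Y k \<omega>))" for \<omega>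
      unfolding w_def by (simp add: ennreal_mult[symmetric] exp_add mult_ac)
    ultimately show ?case
      using Kpos by (simp add: K_def ennreal_mult[symmetric] mult_ac)
  qed
  from this[OF order_refl, of "\<lambda>_. 0"] show ?thesis by simp
qed

end

section \<open>Exponential moments of bilinear forms in Gaussian variables\<close>

context gaussian_space
begin

lemma orthonormal_rotate:
  assumes Y: "orthonormal m Y"
    and v: "\<And>k l. k < m \<Longrightarrow> l < m \<Longrightarrow> (\<Sum>i<m. v k i * v l i) = (if k = l then 1 else 0)"
  shows "orthonormal m (\<lambda>k \<omega>. \<Sum>i<m. v k i * Y i \<omega>)"
proof -
  have YG: "Y k \<in> G" if "k < m" for k using Y that by (auto simp: orthonormal_def)
  let ?Z = "\<lambda>k \<omega>. \<Sum>i<m. v k i * Y i \<omega>"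
  have ZG: "?Z k \<in> G" for k by (rule sum_closed) (use YG in auto)
  have YZ: "cov (Y i) (?Z l) = v l i" if "i < m" for i l
  proof -
    have "cov (Y i) (?Z l) = (\<Sum>j<m. v l j * cov (Y i) (Y j))"
      by (rule cov_sum_right) (use YG that in auto)
    also have "\<dots> = (\<Sum>j<m. if j = i then v l j else 0)"
      by (rule sum.cong) (use Y that in \<open>auto simp: orthonormal_def\<close>)
    finally show ?thesis using that by simp
  qed
  have "cov (?Z k) (?Z l) = (if k = l then 1 else 0)" if kl: "k < m" "l < m" for k l
  proof -
    have "cov (?Z k) (?Z l) = cov (?Z l) (?Z k)" by (rule cov_commute)
    also have "\<dots> = (\<Sum>i<m. v k i * cov (?Z l) (Y i))"
      by (rule cov_sum_right[OF ZG]) (use YG in auto)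
    also have "\<dots> = (\<Sum>i<m. v k i * v l i)"
    proof (rule sum.cong[OF refl])
      fix i assume "i \<in> {..<m}"
      then have "cov (?Z l) (Y i) = v l i"
        using YZ[of i l] cov_commute[of "?Z l" "Y i"] by simp
      then show "v k i * cov (?Z l) (Y i) = v k i * v l i" by simp
    qed
    also have "\<dots> = (if k = l then 1 else 0)" by (rule v[OF kl])
    finally show ?thesis .
  qed
  then show ?thesis unfolding orthonormal_def using ZG by blast
qed

text \<open>In an orthonormal system the form is diagonal with eigenvalues c_k, its mean is their
  sum, and the weighted double sum in \<open>var\<close> is twice the sum of their squares. Thus
  \<open>var\<close> says that the numbers 2 t c_k have sum of squares at most s^2, as the product
  bound requires.\<close>

lemma bilinear_exp_bound:
  fixes N :: nat
  assumes U: "\<And>i. i < N \<Longrightarrow> U i \<in> G" and V: "\<And>i. i < N \<Longrightarrow> V i \<in> G"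
    and var: "2 * t\<^sup>2 * (w\<^sup>2 * (\<Sum>i<N. \<Sum>j<N. cov (U i) (U j) * cov (V i) (V j)
        + cov (U i) (V j) * cov (V i) (U j))) \<le> s\<^sup>2"
    and s: "0 \<le> s" "s < 1"
  shows "(\<integral>\<^sup>+\<omega>. ennreal (exp (t * (w * (\<Sum>i<N. U i \<omega> * V i \<omega>) - w * (\<Sum>i<N. cov (U i) (V i))))) \<partial>M)
    \<le> ennreal ((1 - s) powr (- 1 / 2) * exp (- s / 2))"
proof -
  \<comment> \<open>One orthonormal system for both families, so that the mixed covariances are dot
    products as well.\<close>
  define F where "F = U ` {..<N} \<union> V ` {..<N}"
  have "finite F" "F \<subseteq> G" using U V by (auto simp: F_def)
  from gram_schmidt[OF this] obtain m Y where Y: "orthonormal m Y"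
    and exp: "\<forall>Z\<in>F. AE \<omega> in M. Z \<omega> = (\<Sum>k<m. cov Z (Y k) * Y k \<omega>)" by blast
  have YG: "Y k \<in> G" if "k < m" for k using Y that by (auto simp: orthonormal_def)
  have parseval: "cov S Z = (\<Sum>k<m. cov S (Y k) * cov Z (Y k))" if "S \<in> F" "Z \<in> F" for S Z
  proof -
    have "S \<in> G" "Z \<in> G" using that \<open>F \<subseteq> G\<close> by auto
    have "cov S Z = cov S (\<lambda>\<omega>. \<Sum>k<m. cov Z (Y k) * Y k \<omega>)"
      by (rule cov_cong_AE[OF \<open>S \<in> G\<close> \<open>Z \<in> G\<close> sum_closed]) (use YG exp that in auto)
    also have "\<dots> = (\<Sum>k<m. cov Z (Y k) * cov S (Y k))"
      by (rule cov_sum_right[OF \<open>S \<in> G\<close>]) (use YG in auto)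
    finally show ?thesis by (simp add: mult.commute)
  qed
  define a where "a = (\<lambda>i k. cov (U i) (Y k))"
  define b where "b = (\<lambda>i k. cov (V i) (Y k))"
  have UV: "U i \<in> F" "V i \<in> F" if "i < N" for i using that by (auto simp: F_def)
  have aa: "cov (U i) (U j) = (\<Sum>k<m. a i k * a j k)"
    and bb: "cov (V i) (V j) = (\<Sum>k<m. b i k * b j k)"
    and ab: "cov (U i) (V j) = (\<Sum>k<m. a i k * b j k)"
    and ba: "cov (V i) (U j) = (\<Sum>k<m. b i k * a j k)" if "i < N" "j < N" for i j
    unfolding a_def b_def by (intro parseval UV that)+
  \<comment> \<open>The coefficient matrix of the form need not be symmetric; its symmetric part
    defines the same form and can be diagonalised.\<close>
  define B where "B = (\<lambda>k l. w / 2 * (\<Sum>i<N. a i k * b i l + a i l * b i k))"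
  have Bsym: "B k l = B l k" for k l unfolding B_def by (simp add: add.commute)
  obtain v c where v: "\<And>k l. k < m \<Longrightarrow> l < m \<Longrightarrow> (\<Sum>i<m. v k i * v l i) = (if k = l then 1 else 0)"
    and B: "\<And>i j. i < m \<Longrightarrow> j < m \<Longrightarrow> B i j = (\<Sum>k<m. c k * v k i * v k j)"
    by (rule symmetric_spectral[where B = B and m = m, OF Bsym]) (rule that)
  note tr = spectral_trace[where m = m and B = B and v = v and c = c, OF v B]
  define Y' where "Y' = (\<lambda>k \<omega>. \<Sum>i<m. v k i * Y i \<omega>)"
  have Y': "orthonormal m Y'" unfolding Y'_def by (rule orthonormal_rotate[OF Y v])
  have trace: "w * (\<Sum>i<N. cov (U i) (V i)) = (\<Sum>k<m. c k)"
  proof -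
    have "(\<Sum>k<m. B k k) = (\<Sum>k<m. \<Sum>i<N. w * (a i k * b i k))"
      by (simp add: B_def sum_distrib_left)
    also have "\<dots> = (\<Sum>i<N. \<Sum>k<m. w * (a i k * b i k))" by (rule sum.swap)
    also have "\<dots> = w * (\<Sum>i<N. cov (U i) (V i))"
      by (simp add: sum_distrib_left ab)
    finally show ?thesis using tr(1) by simp
  qed
  have frob: "2 * (\<Sum>k<m. (c k)\<^sup>2) = w\<^sup>2 * (\<Sum>i<N. \<Sum>j<N. cov (U i) (U j) * cov (V i) (V j)
        + cov (U i) (V j) * cov (V i) (U j))"
  proof -
    have "(\<Sum>k<m. (c k)\<^sup>2) = (\<Sum>k<m. \<Sum>l<m. (B k l)\<^sup>2)" by (rule tr(2)[symmetric])
    also have "\<dots> = (w / 2)\<^sup>2 * (\<Sum>k<m. \<Sum>l<m. (\<Sum>i<N. a i k * b i l + a i l * b i k)\<^sup>2)"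
      unfolding B_def power_mult_distrib by (simp only: sum_distrib_left[where r = "(w / 2)\<^sup>2"])
    also have "(\<Sum>k<m. \<Sum>l<m. (\<Sum>i<N. a i k * b i l + a i l * b i k)\<^sup>2)
      = 2 * (\<Sum>i<N. \<Sum>j<N. cov (U i) (U j) * cov (V i) (V j) + cov (U i) (V j) * cov (V i) (U j))"
      by (simp add: symmetrized_product_norm aa bb ab ba)
    finally show ?thesis by (simp add: power_divide)
  qed
  have AE: "AE \<omega> in M. w * (\<Sum>i<N. U i \<omega> * V i \<omega>) = (\<Sum>k<m. c k * (Y' k \<omega>)\<^sup>2)"
  proof -
    have "AE \<omega> in M. \<forall>Z\<in>F. Z \<omega> = (\<Sum>k<m. cov Z (Y k) * Y k \<omega>)"
      using exp \<open>finite F\<close> by (subst AE_ball_countable) (auto simp: countable_finite)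
    then show ?thesis
    proof eventually_elim
      case (elim \<omega>)
      have "w * (\<Sum>i<N. U i \<omega> * V i \<omega>) = w * (\<Sum>i<N. (\<Sum>k<m. a i k * Y k \<omega>) * (\<Sum>l<m. b i l * Y l \<omega>))"
        using elim UV unfolding a_def b_def by (intro arg_cong[of _ _ "\<lambda>x. w * x"] sum.cong refl) auto
      also have "\<dots> = (\<Sum>i<N. \<Sum>k<m. \<Sum>l<m. w * (a i k * b i l) * Y k \<omega> * Y l \<omega>)"
        unfolding sum_product unfolding sum_distrib_left by (intro sum.cong refl) (simp only: mult_ac)
      also have "\<dots> = (\<Sum>k<m. \<Sum>i<N. \<Sum>l<m. w * (a i k * b i l) * Y k \<omega> * Y l \<omega>)" by (rule sum.swap)
      also have "\<dots> = (\<Sum>k<m. \<Sum>l<m. \<Sum>i<N. w * (a i k * b i l) * Y k \<omega> * Y l \<omega>)"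
        by (rule sum.cong[OF refl], rule sum.swap)
      also have "\<dots> = (\<Sum>k<m. \<Sum>l<m. (\<Sum>i<N. w * (a i k * b i l)) * Y k \<omega> * Y l \<omega>)"
        by (simp add: sum_distrib_right)
      finally have "w * (\<Sum>i<N. U i \<omega> * V i \<omega>) = (\<Sum>k<m. \<Sum>l<m. (\<Sum>i<N. w * (a i k * b i l)) * Y k \<omega> * Y l \<omega>)" .
      \<comment> \<open>Exchanging k and l shows that the transposed coefficients give the same
        value; the sum of both expressions is twice the form of \<open>B\<close>.\<close>
      moreover have "\<dots> = (\<Sum>k<m. \<Sum>l<m. (\<Sum>i<N. w * (a i l * b i k)) * Y k \<omega> * Y l \<omega>)"
        by (subst sum.swap) (simp add: mult_ac)
      ultimately have "2 * (w * (\<Sum>i<N. U i \<omega> * V i \<omega>)) =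
          (\<Sum>k<m. \<Sum>l<m. ((\<Sum>i<N. w * (a i k * b i l)) + (\<Sum>i<N. w * (a i l * b i k))) * Y k \<omega> * Y l \<omega>)"
        by (simp add: distrib_right sum.distrib)
      also have "\<dots> = (\<Sum>k<m. \<Sum>l<m. 2 * (B k l * Y k \<omega> * Y l \<omega>))"
      proof -
        have "(\<Sum>i<N. w * (a i k * b i l)) + (\<Sum>i<N. w * (a i l * b i k)) = 2 * B k l" for k l
          unfolding B_def by (simp add: sum_distrib_left[symmetric] sum.distrib distrib_left[symmetric])
        then show ?thesis by (simp add: mult.assoc)
      qed
      also have "\<dots> = 2 * (\<Sum>k<m. \<Sum>l<m. B k l * Y k \<omega> * Y l \<omega>)" by (simp add: sum_distrib_left)
      finally show ?case unfolding Y'_def using tr(3)[of "\<lambda>i. Y i \<omega>"] by simp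
    qed
  qed
  \<comment> \<open>With this scaling, exp (t c_k (Y^2 - 1)) equals exp (x_k Y^2 / 2) exp (- x_k /
    2), the factor handled by \<open>orthonormal_exp_squares\<close> and
    \<open>carleman_product_bound\<close>.\<close>
  define x where "x = (\<lambda>k. 2 * t * c k)"
  have xs: "(\<Sum>k<m. (x k)\<^sup>2) \<le> s\<^sup>2"
  proof -
    have "(\<Sum>k<m. (x k)\<^sup>2) = 2 * t\<^sup>2 * (2 * (\<Sum>k<m. (c k)\<^sup>2))"
      by (simp add: x_def power_mult_distrib sum_distrib_left mult.assoc)
    then show ?thesis using var unfolding frob by simp
  qed
  have x1: "x k < 1" if "k < m" for k
  proof -
    have "(x k)\<^sup>2 \<le> (\<Sum>k<m. (x k)\<^sup>2)" using that by (intro member_le_sum) auto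
    then have "(x k)\<^sup>2 \<le> s\<^sup>2" using xs by linarith
    then have "x k \<le> s" using s(1) by (rule power2_le_imp_le)
    then show ?thesis using s by simp
  qed
  let ?e = "exp (- (\<Sum>k<m. x k) / 2)"
  have [measurable]: "(\<lambda>\<omega>. \<Sum>k<m. x k * (Y' k \<omega>)\<^sup>2 / 2) \<in> borel_measurable M"
  proof (rule borel_measurable_sum)
    fix k assume "k \<in> {..<m}"
    then have [measurable]: "Y' k \<in> borel_measurable M"
      using Y' by (intro measurable_G) (simp add: orthonormal_def)
    show "(\<lambda>\<omega>. x k * (Y' k \<omega>)\<^sup>2 / 2) \<in> borel_measurable M" by measurable
  qed
  have "(\<integral>\<^sup>+\<omega>. ennreal (exp (t * (w * (\<Sum>i<N. U i \<omega> * V i \<omega>) - w * (\<Sum>i<N. cov (U i) (V i))))) \<partial>M)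
      = (\<integral>\<^sup>+\<omega>. ennreal ?e * ennreal (exp (\<Sum>k<m. x k * (Y' k \<omega>)\<^sup>2 / 2)) \<partial>M)"
  proof (rule nn_integral_cong_AE)
    show "AE \<omega> in M. ennreal (exp (t * (w * (\<Sum>i<N. U i \<omega> * V i \<omega>) - w * (\<Sum>i<N. cov (U i) (V i)))))
      = ennreal ?e * ennreal (exp (\<Sum>k<m. x k * (Y' k \<omega>)\<^sup>2 / 2))"
      using AE
    proof eventually_elim
      case (elim \<omega>)
      have "t * (w * (\<Sum>i<N. U i \<omega> * V i \<omega>) - w * (\<Sum>i<N. cov (U i) (V i)))
          = - (\<Sum>k<m. x k) / 2 + (\<Sum>k<m. x k * (Y' k \<omega>)\<^sup>2 / 2)"
        unfolding elim trace x_def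
        by (simp add: right_diff_distrib sum_distrib_left sum_divide_distrib mult.assoc sum_negf[symmetric])
      then show ?case by (simp only: ennreal_mult[symmetric] exp_add exp_ge_zero)
    qed
  qed
  also have "\<dots> = ennreal ?e * ennreal (\<Prod>k<m. (1 - x k) powr (- 1 / 2))"
    by (subst nn_integral_cmult) (simp_all add: orthonormal_exp_squares[OF Y' x1])
  also have "\<dots> = ennreal ((\<Prod>k<m. (1 - x k) powr (- 1 / 2)) * ?e)"
    by (simp add: ennreal_mult[symmetric] prod_nonneg mult.commute)
  also have "\<dots> \<le> ennreal ((1 - s) powr (- 1 / 2) * exp (- s / 2))"
    by (rule ennreal_leI[OF carleman_product_bound[OF xs s]])
  finally show ?thesis .
qed

end

section \<open>Riemann sums\<close>

text \<open>The left end of the mesh cell of t. Replacing t by \<open>grid h t\<close> in an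
  integrand turns the integral over [0, N h) into a Riemann sum, so that sums and integrals are
  compared under one integral sign.\<close>

definition grid :: "real \<Rightarrow> real \<Rightarrow> real" where
  "grid h t = of_int \<lfloor>t / h\<rfloor> * h"

lemma grid_bounds:
  assumes "h > 0"
  shows "grid h t \<le> t" "t < grid h t + h" "t \<ge> 0 \<Longrightarrow> grid h t \<ge> 0"
proof -
  have "of_int \<lfloor>t / h\<rfloor> \<le> t / h" "t / h < of_int \<lfloor>t / h\<rfloor> + 1" by linarith+
  then show "grid h t \<le> t" "t < grid h t + h"
    unfolding grid_def pos_le_divide_eq[OF assms] pos_divide_less_eq[OF assms]
    by (simp_all add: distrib_right)
  show "t \<ge> 0 \<Longrightarrow> grid h t \<ge> 0" using assms by (simp add: grid_def)
qed

lemma grid_measurable [measurable]: "grid h \<in> borel_measurable borel"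
  unfolding grid_def by measurable

lemma grid_step_function:
  fixes F :: "real \<Rightarrow> real"
  assumes "h > 0"
  shows "indicator {0..<real N * h} t * F (grid h t)
    = (\<Sum>i<N. F (real i * h) * indicator {real i * h..<(real i + 1) * h} t)"
proof -
  \<comment> \<open>Half-open cells make the index of the cell exactly the floor of t / h, so at
    most one summand is nonzero.\<close>
  have ind: "t \<in> {real i * h..<(real i + 1) * h} \<longleftrightarrow> \<lfloor>t / h\<rfloor> = int i" for i
    using assms by (simp add: floor_eq_iff field_simps)
  have indr: "indicator {real i * h..<(real i + 1) * h} t = (if \<lfloor>t / h\<rfloor> = int i then 1 else 0 :: real)" for i
    unfolding indicator_def ind by simp
  show ?thesis
  proof (cases "t \<in> {0..<real N * h}")
    case True
    then have "0 \<le> t / h" "t / h < real N" using assms by (auto simp: field_simps)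
    then obtain n where n: "\<lfloor>t / h\<rfloor> = int n" "n < N"
      by (metis floor_less_iff of_int_of_nat_eq of_nat_less_iff zero_le_floor zero_le_imp_eq_int)
    have "(\<Sum>i<N. F (real i * h) * indicator {real i * h..<(real i + 1) * h} t)
        = (\<Sum>i<N. if i = n then F (real i * h) else 0)"
      by (intro sum.cong refl) (use n(1) in \<open>auto simp: indr\<close>)
    then show ?thesis using True n by (simp add: grid_def)
  next
    case False
    have "\<lfloor>t / h\<rfloor> \<noteq> int i" if "i < N" for i
    proof
      assume "\<lfloor>t / h\<rfloor> = int i"
      then have t: "real i * h \<le> t" "t < (real i + 1) * h" using ind[of i] by auto
      have "(real i + 1) * h \<le> real N * h" "0 \<le> real i * h"
        using that assms by (intro mult_right_mono mult_nonneg_nonneg; simp)+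
      then have "0 \<le> t" "t < real N * h" using t by linarith+
      then show False using False by simp
    qed
    then have "(\<Sum>i<N. F (real i * h) * indicator {real i * h..<(real i + 1) * h} t) = 0"
      by (intro sum.neutral) (auto simp: indr)
    then show ?thesis using False by simp
  qed
qed

lemma has_bochner_integral_grid:
  fixes F :: "real \<Rightarrow> real"
  assumes "h > 0"
  shows "has_bochner_integral lborel (\<lambda>t. indicator {0..<real N * h} t * F (grid h t)) (h * (\<Sum>i<N. F (real i * h)))"
proof -
  have "has_bochner_integral lborel (\<lambda>t. \<Sum>i<N. F (real i * h) * indicator {real i * h..<(real i + 1) * h} t)
      (\<Sum>i<N. F (real i * h) * h)"
  proof (intro has_bochner_integral_sum has_bochner_integral_mult_right)
    fix i
    have e: "emeasure lborel {real i * h..<(real i + 1) * h} = ennreal h"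
      using assms by (simp add: algebra_simps)
    have "measure lborel {real i * h..<(real i + 1) * h} = h"
      using assms by (simp add: measure_def e)
    then show "has_bochner_integral lborel (indicator {real i * h..<(real i + 1) * h}) h"
      using has_bochner_integral_real_indicator[of "{real i * h..<(real i + 1) * h}" lborel] e by simp
  qed
  then show ?thesis unfolding grid_step_function[OF assms] by (simp add: sum_distrib_left mult.commute)
qed

lemma set_integral_atLeastLessThan:
  fixes f :: "real \<Rightarrow> real"
  assumes [measurable]: "f \<in> borel_measurable borel"
  shows "(\<integral>t\<in>{0..T}. f t \<partial>lborel) = (\<integral>t. indicator {0..<T} t * f t \<partial>lborel)"
  unfolding set_lebesgue_integral_def
proof (rule integral_cong_AE)
  show "AE t in lborel. indicat_real {0..T} t *\<^sub>R f t = indicat_real {0..<T} t * f t"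
    using AE_lborel_singleton[of T] by eventually_elim (auto simp: indicator_def)
qed simp_all

text \<open>Dominated convergence for F (grid t): the grid points tend to t and stay in [0, T],
  where the continuous F is bounded.\<close>

lemma riemann_sum_tendsto:
  fixes F :: "real \<Rightarrow> real"
  assumes cont: "continuous_on UNIV F" and T: "T > 0"
  shows "(\<lambda>n. (T / Suc n) * (\<Sum>i<Suc n. F (real i * (T / Suc n)))) \<longlonglongrightarrow> (\<integral>t\<in>{0..T}. F t \<partial>lborel)"
proof -
  have [measurable]: "F \<in> borel_measurable borel" by (rule borel_measurable_continuous_onI[OF cont])
  let ?h = "\<lambda>n. T / Suc n"
  have h: "?h n > 0" "real (Suc n) * ?h n = T" for n using T by auto
  have "compact (F ` {0..T})"
    by (rule compact_continuous_image[OF continuous_on_subset[OF cont]]) auto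
  then obtain C where C: "\<And>t. t \<in> {0..T} \<Longrightarrow> \<bar>F t\<bar> \<le> C"
    by (metis bounded_iff compact_imp_bounded imageI real_norm_def)
  have "(\<lambda>n. \<integral>t. indicator {0..<T} t * F (grid (?h n) t) \<partial>lborel) \<longlonglongrightarrow> (\<integral>t. indicator {0..<T} t * F t \<partial>lborel)"
  proof (rule integral_dominated_convergence[where w = "\<lambda>t. C * indicator {0..<T} t"])
    show "integrable lborel (\<lambda>t. C * indicator {0..<T} t)" using T by simp
    show "AE t in lborel. (\<lambda>n. indicator {0..<T} t * F (grid (?h n) t)) \<longlonglongrightarrow> indicator {0..<T} t * F t"
    proof (intro AE_I2 tendsto_mult tendsto_const)
      fix t
      have h0: "(\<lambda>n. ?h n) \<longlonglongrightarrow> 0" using LIMSEQ_Suc[OF lim_const_over_n[of T]] by simp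
      have "(\<lambda>n. grid (?h n) t) \<longlonglongrightarrow> t"
      proof (rule tendsto_sandwich[where f = "\<lambda>n. t - ?h n" and h = "\<lambda>n. t"])
        show "(\<lambda>n. t - ?h n) \<longlonglongrightarrow> t" using tendsto_diff[OF tendsto_const h0, of t] by simp
        show "\<forall>\<^sub>F n in sequentially. t - ?h n \<le> grid (?h n) t"
        proof (intro always_eventually allI)
          fix n show "t - ?h n \<le> grid (?h n) t" using grid_bounds(2)[of "?h n" t] h(1)[of n] by linarith
        qed
        show "\<forall>\<^sub>F n in sequentially. grid (?h n) t \<le> t"
          by (intro always_eventually allI grid_bounds(1) h(1))
      qed simp
      then show "(\<lambda>n. F (grid (?h n) t)) \<longlonglongrightarrow> F t"
        using cont by (intro isCont_tendsto_compose[of t F]) (auto simp: continuous_on_eq_continuous_at)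
    qed
    show "AE t in lborel. norm (indicator {0..<T} t * F (grid (?h n) t)) \<le> C * indicator {0..<T} t" for n
    proof (intro AE_I2)
      fix t
      show "norm (indicator {0..<T} t * F (grid (?h n) t)) \<le> C * indicator {0..<T} t"
      proof (cases "t \<in> {0..<T}")
        case True
        then have "grid (?h n) t \<in> {0..T}" using grid_bounds[OF h(1)[of n], of t] by auto
        then show ?thesis using True C by (simp add: abs_mult)
      qed simp
    qed
  qed simp_all
  moreover have "(\<integral>t. indicator {0..<T} t * F (grid (?h n) t) \<partial>lborel) = ?h n * (\<Sum>i<Suc n. F (real i * ?h n))" for n
    using has_bochner_integral_integral_eq[OF has_bochner_integral_grid[OF h(1)[of n], of "Suc n" F]] unfolding h(2) .
  ultimately show ?thesis by (simp only: set_integral_atLeastLessThan[OF \<open>F \<in> _\<close>])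
qed

text \<open>Summation along diagonals: a difference k > 0 occurs N - k times with either sign, while
  the main diagonal is counted twice on the right, whence the correction N f(0).\<close>

lemma double_sum_differences:
  fixes f :: "real \<Rightarrow> real"
  assumes even: "\<And>u. f (- u) = f u"
  shows "(\<Sum>i<N. \<Sum>j<N. f ((real i - real j) * h)) = 2 * (\<Sum>k<N. (real N - real k) * f (real k * h)) - real N * f 0"
proof (induction N)
  case 0 then show ?case by simp
next
  case (Suc N)
  have sw: "f ((real i - real j) * h) = f ((real j - real i) * h)" for i j
    using even[of "(real i - real j) * h"] by (simp add: algebra_simps)
  have r: "(\<Sum>i<N. f ((real N - real i) * h)) = (\<Sum>k<N. f (real (Suc k) * h))"
    by (rule sum.reindex_bij_witness[of _ "\<lambda>k. N - Suc k" "\<lambda>i. N - Suc i"])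
      (auto simp: of_nat_diff Suc_diff_Suc)
  have "(\<Sum>k<Suc N. f (real k * h)) = f 0 + (\<Sum>k<N. f (real (Suc k) * h))"
    by (subst sum.lessThan_Suc_shift) simp
  then have r': "(\<Sum>k<N. f (real (Suc k) * h)) = (\<Sum>k<Suc N. f (real k * h)) - f 0" by simp
  have "(\<Sum>i<Suc N. \<Sum>j<Suc N. f ((real i - real j) * h))
      = (\<Sum>i<N. \<Sum>j<N. f ((real i - real j) * h)) + 2 * (\<Sum>i<N. f ((real N - real i) * h)) + f 0"
    by (simp add: sum.distrib sw[of _ N])
  also have "\<dots> = 2 * ((\<Sum>k<N. (real N - real k) * f (real k * h)) + (\<Sum>k<Suc N. f (real k * h))) - real N * f 0 - f 0"
    unfolding Suc.IH r r' by simp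
  also have "(\<Sum>k<N. (real N - real k) * f (real k * h)) + (\<Sum>k<Suc N. f (real k * h))
      = (\<Sum>k<Suc N. (real (Suc N) - real k) * f (real k * h))"
  proof -
    have "(\<Sum>k<Suc N. (real (Suc N) - real k) * f (real k * h))
        = (\<Sum>k<Suc N. (real N - real k) * f (real k * h)) + (\<Sum>k<Suc N. f (real k * h))"
      unfolding sum.distrib[symmetric] by (intro sum.cong refl) (simp add: algebra_simps)
    then show ?thesis by simp
  qed
  finally show ?case by (simp add: algebra_simps)
qed

text \<open>The multiplicity N - k of a difference becomes the weight T - u in C_p, and the diagonal
  correction is f(0) / N, which vanishes in the limit.\<close>

lemma mean_double_sum_tendsto:
  fixes f :: "real \<Rightarrow> real"
  assumes even: "\<And>u. f (- u) = f u" and cont: "continuous_on UNIV f" and T: "T > 0"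
  shows "(\<lambda>n. (1 / Suc n)\<^sup>2 * (\<Sum>i<Suc n. \<Sum>j<Suc n. f (real i * (T / Suc n) - real j * (T / Suc n))))
    \<longlonglongrightarrow> 2 / T\<^sup>2 * (\<integral>u\<in>{0..T}. (T - u) * f u \<partial>lborel)"
proof -
  have eq: "(1 / Suc n)\<^sup>2 * (\<Sum>i<Suc n. \<Sum>j<Suc n. f (real i * (T / Suc n) - real j * (T / Suc n)))
    = 2 / T\<^sup>2 * ((T / Suc n) * (\<Sum>i<Suc n. (T - real i * (T / Suc n)) * f (real i * (T / Suc n)))) - f 0 / Suc n" for n
  proof -
    define N where "N = real (Suc n)"
    have N: "N > 0" by (simp add: N_def)
    define S where "S = (\<Sum>k<Suc n. (N - real k) * f (real k * (T / N)))"
    have "(\<Sum>i<Suc n. \<Sum>j<Suc n. f (real i * (T / N) - real j * (T / N))) = 2 * S - N * f 0"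
      using double_sum_differences[where f = f and h = "T / N" and N = "Suc n", OF even] by (simp only: left_diff_distrib N_def S_def)
    moreover have "(\<Sum>i<Suc n. (T - real i * (T / N)) * f (real i * (T / N))) = (T / N) * S"
      unfolding S_def sum_distrib_left
      by (intro sum.cong refl) (use N in \<open>simp add: field_simps\<close>)
    ultimately show ?thesis
      unfolding N_def[symmetric] using N T by (simp add: field_simps power2_eq_square)
  qed
  have "(\<lambda>n. f 0 / Suc n) \<longlonglongrightarrow> 0" using LIMSEQ_Suc[OF lim_const_over_n[of "f 0"]] by simp
  moreover have "continuous_on UNIV (\<lambda>u. (T - u) * f u)"
    by (intro continuous_on_mult continuous_on_diff continuous_on_const continuous_on_id cont)
  note tendsto_mult[OF tendsto_const[of "2 / T\<^sup>2"] riemann_sum_tendsto[OF this T]]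
  ultimately show ?thesis unfolding eq using tendsto_diff[of _ _ sequentially "\<lambda>n. f 0 / Suc n" 0] by fastforce
qed

section \<open>Stationary Gaussian processes\<close>

context gaussian_space
begin

text \<open>The absolute value stays inside the expectation because the estimate is used for L^1
  distances.\<close>

lemma cov_Cauchy_Schwarz:
  assumes "Y \<in> G" "Z \<in> G"
  shows "expectation (\<lambda>\<omega>. \<bar>Y \<omega> * Z \<omega>\<bar>) \<le> sqrt (cov Y Y) * sqrt (cov Z Z)"
proof -
  note [measurable] = measurable_G[OF assms(1)] measurable_G[OF assms(2)]
  have sq: "(\<integral>\<^sup>+\<omega>. (ennreal \<bar>S \<omega>\<bar>)\<^sup>2 \<partial>M) = ennreal (cov S S)" if "S \<in> G" for S
  proof -
    have "(\<integral>\<^sup>+\<omega>. (ennreal \<bar>S \<omega>\<bar>)\<^sup>2 \<partial>M) = (\<integral>\<^sup>+\<omega>. ennreal (S \<omega> * S \<omega>) \<partial>M)"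
      by (intro nn_integral_cong) (simp add: ennreal_power, simp only: power2_eq_square)
    also have "\<dots> = ennreal (cov S S)"
      by (rule nn_integral_eq_integral[OF prod_integrable[OF that that]]) simp
    finally show ?thesis .
  qed
  have nn: "cov S S \<ge> 0" for S by (rule Bochner_Integration.integral_nonneg) simp
  let ?E = "expectation (\<lambda>\<omega>. \<bar>Y \<omega> * Z \<omega>\<bar>)"
  have "ennreal ?E = (\<integral>\<^sup>+\<omega>. ennreal \<bar>Y \<omega> * Z \<omega>\<bar> \<partial>M)"
    by (rule nn_integral_eq_integral[OF integrable_abs[OF prod_integrable[OF assms]], symmetric]) simp
  also have "\<dots> = (\<integral>\<^sup>+\<omega>. ennreal \<bar>Y \<omega>\<bar> * ennreal \<bar>Z \<omega>\<bar> \<partial>M)"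
    by (simp add: abs_mult ennreal_mult)
  finally have "(ennreal ?E)\<^sup>2 \<le> ennreal (cov Y Y) * ennreal (cov Z Z)"
    using Cauchy_Schwarz_nn_integral[of "\<lambda>\<omega>. ennreal \<bar>Y \<omega>\<bar>" M "\<lambda>\<omega>. ennreal \<bar>Z \<omega>\<bar>"]
    by (simp add: sq assms)
  moreover have "?E \<ge> 0" by (rule Bochner_Integration.integral_nonneg) simp
  ultimately have "?E\<^sup>2 \<le> cov Y Y * cov Z Z"
    using nn[of Y] nn[of Z] by (simp add: ennreal_power ennreal_mult[symmetric])
  then have "?E \<le> sqrt (cov Y Y * cov Z Z)" using real_le_rsqrt by blast
  then show ?thesis by (simp add: real_sqrt_mult)
qed

end

definition process_span :: "(real \<Rightarrow> 'a \<Rightarrow> real) \<Rightarrow> ('a \<Rightarrow> real) set" where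
  "process_span X = {\<lambda>\<omega>. \<Sum>t\<in>I. c t * X t \<omega> | I c. finite I}"

lemma process_spanI: "finite I \<Longrightarrow> (\<lambda>\<omega>. \<Sum>t\<in>I. c t * X t \<omega>) \<in> process_span X"
  unfolding process_span_def by (intro CollectI exI[of _ I] exI[of _ c] conjI refl)

locale stationary_gaussian = prob_space M for M :: "'a measure" +
  fixes X :: "real \<Rightarrow> 'a \<Rightarrow> real" and \<rho> :: "real \<Rightarrow> real"
  assumes meas: "measurable_process M X"
    and gaussian: "gaussian_process M X"
    and mean: "expectation (X t) = 0"
    and covariance: "expectation (\<lambda>\<omega>. X (t + \<tau>) \<omega> * X t \<omega>) = \<rho> \<tau>"
    and cont: "continuous_on UNIV \<rho>"
begin

lemma X_gaussian: "gaussian_rv M (X t)"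
  using gaussian[unfolded gaussian_process_def, rule_format, of "{t}" "\<lambda>_. 1"] by simp

lemma X_integrable: "integrable M (X t)"
proof -
  have [measurable]: "X t \<in> borel_measurable M" using X_gaussian by (simp add: gaussian_rv_def)
  consider \<mu> \<sigma> where "\<sigma> > 0" "distributed M lborel (X t) (normal_density \<mu> \<sigma>)"
    | c where "AE \<omega> in M. X t \<omega> = c"
    using X_gaussian[of t] unfolding gaussian_rv_def by blast
  then show ?thesis
  proof cases
    case 1
    then show ?thesis
      using distributed_integrable[OF 1(2), of "\<lambda>x. x"] integrable_normal_moment_nz_1[OF 1(1), of \<mu>] by simp
  next
    case 2
    then have "integrable M (X t) \<longleftrightarrow> integrable M (\<lambda>\<omega>. c)" by (intro integrable_cong_AE) auto
    then show ?thesis by simp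
  qed
qed

sublocale gaussian_space M "process_span X"
proof
  fix Z assume "Z \<in> process_span X"
  then obtain I c where I: "finite I" and Z: "Z = (\<lambda>\<omega>. \<Sum>t\<in>I. c t * X t \<omega>)"
    by (auto simp: process_span_def)
  show "gaussian_rv M Z" unfolding Z by (rule gaussian[unfolded gaussian_process_def, rule_format, OF I])
  show "expectation Z = 0" unfolding Z by (simp add: X_integrable mean)
next
  show "(\<lambda>_. 0) \<in> process_span X"
    using process_spanI[of "{}"] by simp
next
  fix Y Z assume "Y \<in> process_span X" "Z \<in> process_span X"
  then obtain I c J d where I: "finite I" "finite J"
    and Y: "Y = (\<lambda>\<omega>. \<Sum>t\<in>I. c t * X t \<omega>)" and Z: "Z = (\<lambda>\<omega>. \<Sum>t\<in>J. d t * X t \<omega>)"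
    by (auto simp: process_span_def)
  \<comment> \<open>A combination lists each time once, so both are first extended by zero
    coefficients to the union of the index sets.\<close>
  have "Y \<omega> + Z \<omega> = (\<Sum>t\<in>I \<union> J. ((if t \<in> I then c t else 0) + (if t \<in> J then d t else 0)) * X t \<omega>)" for \<omega>
  proof -
    have "Y \<omega> = (\<Sum>t\<in>I \<union> J. (if t \<in> I then c t else 0) * X t \<omega>)"
      unfolding Y using I by (intro sum.mono_neutral_cong_left) auto
    moreover have "Z \<omega> = (\<Sum>t\<in>I \<union> J. (if t \<in> J then d t else 0) * X t \<omega>)"
      unfolding Z using I by (intro sum.mono_neutral_cong_left) auto
    ultimately show ?thesis by (simp only: distrib_right sum.distrib)
  qed
  then have "(\<lambda>\<omega>. Y \<omega> + Z \<omega>) = (\<lambda>\<omega>. \<Sum>t\<in>I \<union> J. ((if t \<in> I then c t else 0) + (if t \<in> J then d t else 0)) * X t \<omega>)"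
    by (rule ext)
  then show "(\<lambda>\<omega>. Y \<omega> + Z \<omega>) \<in> process_span X"
    using process_spanI[OF finite_UnI[OF I]] by (simp only:)
next
  fix Z a assume "Z \<in> process_span X"
  then obtain I c where I: "finite I" and Z: "Z = (\<lambda>\<omega>. \<Sum>t\<in>I. c t * X t \<omega>)"
    by (auto simp: process_span_def)
  show "(\<lambda>\<omega>. a * Z \<omega>) \<in> process_span X"
    using process_spanI[OF I, of "\<lambda>t. a * c t"] by (simp add: Z sum_distrib_left mult.assoc)
qed

lemma X_in: "X t \<in> process_span X"
  using process_spanI[of "{t}" "\<lambda>_. 1"] by simp

lemma cov_X: "cov (X s) (X t) = \<rho> (s - t)"
  using covariance[of t "s - t"] by simp

lemma \<rho>_even: "\<rho> (- u) = \<rho> u"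
  using cov_X[of 0 u] cov_X[of u 0] cov_commute[of "X 0" "X u"] by simp

lemma \<rho>_0_nonneg: "\<rho> 0 \<ge> 0"
proof -
  have "cov (X 0) (X 0) \<ge> 0" by (rule Bochner_Integration.integral_nonneg) simp
  then show ?thesis by (simp add: cov_X)
qed

text \<open>Joint measurability in this form lets the time be any measurable function, in particular
  a grid point or t + \<tau>, which Fubini's theorem relies on.\<close>

lemma X_measurable [measurable (raw)]:
  assumes "f \<in> borel_measurable K" "g \<in> measurable K M"
  shows "(\<lambda>x. X (f x) (g x)) \<in> borel_measurable K"
proof -
  have "(\<lambda>x. (f x, g x)) \<in> measurable K (lborel \<Otimes>\<^sub>M M)" using assms by measurable
  from measurable_compose[OF this meas[unfolded measurable_process_def]] show ?thesis by simp
qed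

lemma cov_increment:
  "(\<lambda>\<omega>. X a \<omega> + (-1) * X b \<omega>) \<in> process_span X"
  "cov (\<lambda>\<omega>. X a \<omega> + (-1) * X b \<omega>) (\<lambda>\<omega>. X a \<omega> + (-1) * X b \<omega>) = 2 * (\<rho> 0 - \<rho> (a - b))"
proof -
  show "(\<lambda>\<omega>. X a \<omega> + (-1) * X b \<omega>) \<in> process_span X" by (intro add scale X_in)
  have int: "integrable M (\<lambda>\<omega>. X s \<omega> * X t \<omega>)" for s t by (rule prod_integrable[OF X_in X_in])
  have ev: "\<rho> (b - a) = \<rho> (a - b)" using \<rho>_even[of "a - b"] by simp
  have "cov (\<lambda>\<omega>. X a \<omega> + (-1) * X b \<omega>) (\<lambda>\<omega>. X a \<omega> + (-1) * X b \<omega>)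
      = expectation (\<lambda>\<omega>. X a \<omega> * X a \<omega> - X a \<omega> * X b \<omega> - X b \<omega> * X a \<omega> + X b \<omega> * X b \<omega>)"
    by (intro Bochner_Integration.integral_cong refl) (simp add: algebra_simps)
  also have "\<dots> = \<rho> 0 - \<rho> (a - b) - \<rho> (b - a) + \<rho> 0"
    using int by (simp add: cov_X ev)
  finally show "cov (\<lambda>\<omega>. X a \<omega> + (-1) * X b \<omega>) (\<lambda>\<omega>. X a \<omega> + (-1) * X b \<omega>) = 2 * (\<rho> 0 - \<rho> (a - b))" by (simp add: ev)
qed

text \<open>A modulus of continuity in L^1 for t \<mapsto> X(t + \<tau>) X(t), uniform in \<tau>:
  the increment over u has variance 2 (\<rho>(0) - \<rho>(u)), the other factor has variance
  \<rho>(0), and each of the two factors is varied once.\<close>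

definition modulus :: "real \<Rightarrow> real" where
  "modulus u = 2 * (sqrt (2 * (\<rho> 0 - \<rho> u)) * sqrt (\<rho> 0))"

text \<open>One factor is changed at a time, and Cauchy-Schwarz bounds each of the two resulting
  products.\<close>

lemma product_increment:
  "expectation (\<lambda>\<omega>. \<bar>X (a + \<tau>) \<omega> * X a \<omega> - X (b + \<tau>) \<omega> * X b \<omega>\<bar>) \<le> modulus (a - b)"
proof -
  let ?D = "\<lambda>a b \<omega>. X a \<omega> + (-1) * X b \<omega>"
  have i: "integrable M (\<lambda>\<omega>. \<bar>?D a b \<omega> * X s \<omega>\<bar>)" for a b s
    by (intro integrable_abs prod_integrable cov_increment X_in)
  have b: "expectation (\<lambda>\<omega>. \<bar>?D a b \<omega> * X s \<omega>\<bar>) \<le> sqrt (2 * (\<rho> 0 - \<rho> (a - b))) * sqrt (\<rho> 0)" for a b s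
    using cov_Cauchy_Schwarz[OF cov_increment(1) X_in, of a b s] unfolding cov_increment(2) by (simp add: cov_X)
  have "expectation (\<lambda>\<omega>. \<bar>X (a + \<tau>) \<omega> * X a \<omega> - X (b + \<tau>) \<omega> * X b \<omega>\<bar>)
      \<le> expectation (\<lambda>\<omega>. \<bar>?D (a + \<tau>) (b + \<tau>) \<omega> * X a \<omega>\<bar> + \<bar>?D a b \<omega> * X (b + \<tau>) \<omega>\<bar>)"
  proof (rule integral_mono)
    show "integrable M (\<lambda>\<omega>. \<bar>X (a + \<tau>) \<omega> * X a \<omega> - X (b + \<tau>) \<omega> * X b \<omega>\<bar>)"
      by (intro integrable_abs Bochner_Integration.integrable_diff prod_integrable X_in)
    show "integrable M (\<lambda>\<omega>. \<bar>?D (a + \<tau>) (b + \<tau>) \<omega> * X a \<omega>\<bar> + \<bar>?D a b \<omega> * X (b + \<tau>) \<omega>\<bar>)"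
      by (intro Bochner_Integration.integrable_add i)
    fix \<omega>
    have *: "X (a + \<tau>) \<omega> * X a \<omega> - X (b + \<tau>) \<omega> * X b \<omega> = ?D (a + \<tau>) (b + \<tau>) \<omega> * X a \<omega> + ?D a b \<omega> * X (b + \<tau>) \<omega>"
      by (simp add: algebra_simps)
    show "\<bar>X (a + \<tau>) \<omega> * X a \<omega> - X (b + \<tau>) \<omega> * X b \<omega>\<bar>
        \<le> \<bar>?D (a + \<tau>) (b + \<tau>) \<omega> * X a \<omega>\<bar> + \<bar>?D a b \<omega> * X (b + \<tau>) \<omega>\<bar>"
      by (subst *) (rule abs_triangle_ineq)
  qed
  also have "\<dots> = expectation (\<lambda>\<omega>. \<bar>?D (a + \<tau>) (b + \<tau>) \<omega> * X a \<omega>\<bar>) + expectation (\<lambda>\<omega>. \<bar>?D a b \<omega> * X (b + \<tau>) \<omega>\<bar>)"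
    by (rule Bochner_Integration.integral_add[OF i i])
  also have "\<dots> \<le> modulus (a - b)"
    using b[of "a + \<tau>" "b + \<tau>" a] b[of a b "b + \<tau>"] by (simp add: modulus_def)
  finally show ?thesis .
qed

lemma modulus_cont: "\<forall>e>0. \<exists>d>0. \<forall>u. \<bar>u\<bar> < d \<longrightarrow> modulus u < e"
proof (intro allI impI)
  fix e :: real assume "e > 0"
  have m0: "modulus 0 = 0" by (simp add: modulus_def)
  have "isCont \<rho> 0" using cont by (simp add: continuous_on_eq_continuous_at)
  then have "isCont modulus 0" unfolding modulus_def
    by (intro continuous_mult continuous_real_sqrt continuous_diff continuous_const)
  then obtain d where "d > 0" "\<And>u. dist u 0 < d \<Longrightarrow> dist (modulus u) (modulus 0) < e"
    using \<open>e > 0\<close> unfolding continuous_at_eps_delta by blast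
  then show "\<exists>d>0. \<forall>u. \<bar>u\<bar> < d \<longrightarrow> modulus u < e"
    by (intro exI[of _ d]) (auto simp: dist_real_def m0 intro: le_less_trans[OF abs_ge_self])
qed

text \<open>The identity as \<open>\<phi>\<close> gives the integrand of the correlogram, a grid
  function that of its Riemann sum. Both are integrable since the expected absolute product never
  exceeds \<rho>(0).\<close>

lemma sampled_integrable:
  fixes T \<tau> :: real
  assumes [measurable]: "\<phi> \<in> borel_measurable borel"
  shows "integrable (lborel \<Otimes>\<^sub>M M) (\<lambda>(t, \<omega>). indicator {0..<T} t * (X (\<phi> t + \<tau>) \<omega> * X (\<phi> t) \<omega>))"
proof -
  interpret P: pair_sigma_finite lborel M ..
  have "emeasure lborel {0..<T} \<le> ennreal (max T 0)" by (cases "0 \<le> T") simp_all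
  then have "emeasure lborel {0..<T} < \<infinity>" by (rule le_less_trans) simp
  then have ic: "integrable lborel (indicat_real {0..<T})" by (intro integrable_real_indicator) simp
  have b: "expectation (\<lambda>\<omega>. \<bar>X (\<phi> t + \<tau>) \<omega> * X (\<phi> t) \<omega>\<bar>) \<le> \<rho> 0" for t
    using cov_Cauchy_Schwarz[OF X_in X_in, of "\<phi> t + \<tau>" "\<phi> t"] \<rho>_0_nonneg by (simp add: cov_X)
  show ?thesis
  proof (rule P.Fubini_integrable)
    show "integrable lborel (\<lambda>t. \<integral>\<omega>. norm (case (t, \<omega>) of (t, \<omega>) \<Rightarrow> indicator {0..<T} t * (X (\<phi> t + \<tau>) \<omega> * X (\<phi> t) \<omega>)) \<partial>M)"
    proof (rule Bochner_Integration.integrable_bound[where f = "\<lambda>t. \<rho> 0 * indicator {0..<T} t"])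
      show "integrable lborel (\<lambda>t. \<rho> 0 * indicator {0..<T} t)"
        by (intro integrable_mult_right ic)
      show "AE t in lborel. norm (\<integral>\<omega>. norm (case (t, \<omega>) of (t, \<omega>) \<Rightarrow> indicator {0..<T} t * (X (\<phi> t + \<tau>) \<omega> * X (\<phi> t) \<omega>)) \<partial>M)
          \<le> norm (\<rho> 0 * indicator {0..<T} t)"
      proof (intro AE_I2)
        fix t
        have "(\<integral>\<omega>. norm (case (t, \<omega>) of (t, \<omega>) \<Rightarrow> indicator {0..<T} t * (X (\<phi> t + \<tau>) \<omega> * X (\<phi> t) \<omega>)) \<partial>M)
            = indicator {0..<T} t * expectation (\<lambda>\<omega>. \<bar>X (\<phi> t + \<tau>) \<omega> * X (\<phi> t) \<omega>\<bar>)"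
          by (auto simp: indicator_def)
        moreover have "expectation (\<lambda>\<omega>. \<bar>X (\<phi> t + \<tau>) \<omega> * X (\<phi> t) \<omega>\<bar>) \<ge> 0"
          by (rule Bochner_Integration.integral_nonneg) simp
        ultimately show "norm (\<integral>\<omega>. norm (case (t, \<omega>) of (t, \<omega>) \<Rightarrow> indicator {0..<T} t * (X (\<phi> t + \<tau>) \<omega> * X (\<phi> t) \<omega>)) \<partial>M)
          \<le> norm (\<rho> 0 * indicator {0..<T} t)"
          using b[of t] by (auto simp: indicator_def)
      qed
    qed measurable
    show "AE t in lborel. integrable M (\<lambda>\<omega>. case (t, \<omega>) of (t, \<omega>) \<Rightarrow> indicator {0..<T} t * (X (\<phi> t + \<tau>) \<omega> * X (\<phi> t) \<omega>))"
      by (intro AE_I2) (use prod_integrable[OF X_in X_in] in auto)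
  qed measurable
qed

end

section \<open>Approximation of the correlogram by quadratic forms, and its exponential
  moments\<close>

context stationary_gaussian
begin

lemma correlogram_eq:
  assumes "\<omega> \<in> space M"
  shows "correlogram T X \<tau> \<omega> = (1 / T) * (\<integral>t. indicator {0..<T} t * (X (t + \<tau>) \<omega> * X t \<omega>) \<partial>lborel)"
proof -
  have [measurable]: "(\<lambda>_::real. \<omega>) \<in> measurable borel M" using assms by simp
  have "(\<lambda>t. X (t + \<tau>) \<omega> * X t \<omega>) \<in> borel_measurable borel" by measurable
  from set_integral_atLeastLessThan[OF this] show ?thesis by (simp add: correlogram_def)
qed

definition sampled :: "real \<Rightarrow> real \<Rightarrow> nat \<Rightarrow> 'a \<Rightarrow> real" where
  "sampled T \<tau> n \<omega> = (1 / Suc n) * (\<Sum>i<Suc n. X (real i * (T / Suc n) + \<tau>) \<omega> * X (real i * (T / Suc n)) \<omega>)"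

text \<open>In this form the sum and the correlogram are integrals over the same interval, and their
  difference is controlled by the increment of the product between t and its grid point.\<close>

lemma sampled_eq:
  assumes "T > 0"
  shows "sampled T \<tau> n \<omega> = (1 / T) * (\<integral>t. indicator {0..<T} t *
    (X (grid (T / Suc n) t + \<tau>) \<omega> * X (grid (T / Suc n) t) \<omega>) \<partial>lborel)"
proof -
  define N where "N = real (Suc n)"
  have N: "N > 0" by (simp add: N_def)
  have h: "T / N > 0" "real (Suc n) * (T / N) = T" using assms by (auto simp: N_def)
  have "(\<integral>t. indicator {0..<T} t * (X (grid (T / N) t + \<tau>) \<omega> * X (grid (T / N) t) \<omega>) \<partial>lborel)
      = (T / N) * (\<Sum>i<Suc n. X (real i * (T / N) + \<tau>) \<omega> * X (real i * (T / N)) \<omega>)"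
    using has_bochner_integral_integral_eq[OF has_bochner_integral_grid[OF h(1), of "Suc n" "\<lambda>u. X (u + \<tau>) \<omega> * X u \<omega>"]]
    unfolding h(2) .
  then show ?thesis unfolding sampled_def N_def[symmetric] using assms N by simp
qed

lemma sampled_L1_bound:
  assumes T: "T > 0" and e: "e > 0" and m: "\<And>t. modulus (t - grid (T / Suc n) t) \<le> e"
  shows "integrable M (\<lambda>\<omega>. correlogram T X \<tau> \<omega> - sampled T \<tau> n \<omega>)"
    and "expectation (\<lambda>\<omega>. norm (correlogram T X \<tau> \<omega> - sampled T \<tau> n \<omega>)) \<le> e"
proof -
  interpret P: pair_sigma_finite lborel M ..
  let ?g = "grid (T / Suc n)"
  define f1 where "f1 = (\<lambda>t \<omega>. indicator {0..<T} t * (X (t + \<tau>) \<omega> * X t \<omega>))"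
  define f2 where "f2 = (\<lambda>t \<omega>. indicator {0..<T} t * (X (?g t + \<tau>) \<omega> * X (?g t) \<omega>))"
  define f where "f = (\<lambda>t \<omega>. f1 t \<omega> - f2 t \<omega>)"
  have i1: "integrable (lborel \<Otimes>\<^sub>M M) (case_prod f1)"
    unfolding f1_def by (rule sampled_integrable) simp
  have i2: "integrable (lborel \<Otimes>\<^sub>M M) (case_prod f2)"
    unfolding f2_def by (rule sampled_integrable) simp
  have i: "integrable (lborel \<Otimes>\<^sub>M M) (case_prod f)"
    using Bochner_Integration.integrable_diff[OF i1 i2] by (simp add: f_def case_prod_beta')
  have ia: "integrable (lborel \<Otimes>\<^sub>M M) (case_prod (\<lambda>t \<omega>. \<bar>f t \<omega>\<bar>))"
    using integrable_abs[OF i] by (simp add: case_prod_beta')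
  have c: "correlogram T X \<tau> \<omega> = (1 / T) * (\<integral>t. f1 t \<omega> \<partial>lborel)" if "\<omega> \<in> space M" for \<omega>
    using correlogram_eq[OF that] by (simp add: f1_def)
  have q: "sampled T \<tau> n \<omega> = (1 / T) * (\<integral>t. f2 t \<omega> \<partial>lborel)" for \<omega>
    using sampled_eq[OF T] by (simp add: f2_def)
  have "integrable M (\<lambda>\<omega>. (1 / T) * (\<integral>t. f1 t \<omega> \<partial>lborel) - (1 / T) * (\<integral>t. f2 t \<omega> \<partial>lborel))"
    by (intro Bochner_Integration.integrable_diff integrable_mult_right P.integrable_snd i1 i2)
  moreover have "integrable M (\<lambda>\<omega>. correlogram T X \<tau> \<omega> - sampled T \<tau> n \<omega>)
    \<longleftrightarrow> integrable M (\<lambda>\<omega>. (1 / T) * (\<integral>t. f1 t \<omega> \<partial>lborel) - (1 / T) * (\<integral>t. f2 t \<omega> \<partial>lborel))"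
    by (rule Bochner_Integration.integrable_cong) (simp_all add: c q)
  ultimately show int: "integrable M (\<lambda>\<omega>. correlogram T X \<tau> \<omega> - sampled T \<tau> n \<omega>)" by simp
  have "expectation (\<lambda>\<omega>. norm (correlogram T X \<tau> \<omega> - sampled T \<tau> n \<omega>))
      \<le> expectation (\<lambda>\<omega>. (1 / T) * (\<integral>t. \<bar>f t \<omega>\<bar> \<partial>lborel))"
  proof (rule integral_mono_AE)
    show "integrable M (\<lambda>\<omega>. norm (correlogram T X \<tau> \<omega> - sampled T \<tau> n \<omega>))"
      by (rule integrable_norm[OF int])
    show "integrable M (\<lambda>\<omega>. (1 / T) * (\<integral>t. \<bar>f t \<omega>\<bar> \<partial>lborel))"
      by (intro integrable_mult_right P.integrable_snd ia)
    \<comment> \<open>The integral of a path that is not integrable is 0 by convention. Fubini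
      excludes such paths up to a null set; only then is the difference of the integrals the
      integral of the difference.\<close>
    show "AE \<omega> in M. norm (correlogram T X \<tau> \<omega> - sampled T \<tau> n \<omega>) \<le> (1 / T) * (\<integral>t. \<bar>f t \<omega>\<bar> \<partial>lborel)"
      using P.AE_integrable_snd[OF i1] P.AE_integrable_snd[OF i2] AE_space
    proof eventually_elim
      case (elim \<omega>)
      have "correlogram T X \<tau> \<omega> - sampled T \<tau> n \<omega> = (1 / T) * (\<integral>t. f t \<omega> \<partial>lborel)"
        unfolding f_def Bochner_Integration.integral_diff[OF elim(1,2)] c[OF elim(3)] q
        by (simp add: right_diff_distrib)
      moreover have "\<bar>\<integral>t. f t \<omega> \<partial>lborel\<bar> \<le> (\<integral>t. \<bar>f t \<omega>\<bar> \<partial>lborel)"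
        by (rule integral_abs_bound)
      ultimately show ?case using T by (simp add: abs_mult divide_right_mono)
    qed
  qed
  also have "\<dots> = (1 / T) * (\<integral>\<omega>. (\<integral>t. \<bar>f t \<omega>\<bar> \<partial>lborel) \<partial>M)" by simp
  also have "(\<integral>\<omega>. (\<integral>t. \<bar>f t \<omega>\<bar> \<partial>lborel) \<partial>M) = (\<integral>t. expectation (\<lambda>\<omega>. \<bar>f t \<omega>\<bar>) \<partial>lborel)"
    by (rule P.Fubini_integral[OF ia])
  also have "(\<integral>t. expectation (\<lambda>\<omega>. \<bar>f t \<omega>\<bar>) \<partial>lborel) \<le> (\<integral>t. e * indicator {0..<T} t \<partial>lborel)"
  proof (rule integral_mono)
    show "integrable lborel (\<lambda>t. expectation (\<lambda>\<omega>. \<bar>f t \<omega>\<bar>))" by (rule P.integrable_fst[OF ia])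
    show "integrable lborel (\<lambda>t. e * indicator {0..<T} t)" using T by simp
    fix t :: real
    have "f t \<omega> = indicator {0..<T} t * (X (t + \<tau>) \<omega> * X t \<omega> - X (?g t + \<tau>) \<omega> * X (?g t) \<omega>)" for \<omega>
      by (simp add: f_def f1_def f2_def right_diff_distrib)
    then have "expectation (\<lambda>\<omega>. \<bar>f t \<omega>\<bar>)
        = indicator {0..<T} t * expectation (\<lambda>\<omega>. \<bar>X (t + \<tau>) \<omega> * X t \<omega> - X (?g t + \<tau>) \<omega> * X (?g t) \<omega>\<bar>)"
      by (simp add: abs_mult)
    also have "\<dots> \<le> indicator {0..<T} t * e"
      using product_increment[of t \<tau> "?g t"] m[of t] by (intro mult_left_mono) auto
    finally show "expectation (\<lambda>\<omega>. \<bar>f t \<omega>\<bar>) \<le> e * indicator {0..<T} t" by (simp add: mult.commute)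
  qed
  also have "(\<integral>t. e * indicator {0..<T} t \<partial>lborel) = e * T" using T by simp
  finally show "expectation (\<lambda>\<omega>. norm (correlogram T X \<tau> \<omega> - sampled T \<tau> n \<omega>)) \<le> e"
    using T by (simp add: divide_right_mono)
qed

text \<open>A crude bound that makes \<open>sampled_L1_bound\<close> applicable on every grid, for
  integrability. The summand 1 keeps it positive when \<rho>(0) = 0.\<close>

lemma modulus_bound: "modulus u \<le> 4 * \<rho> 0 + 1"
proof -
  have b: "\<bar>\<rho> u\<bar> \<le> \<rho> 0"
  proof -
    have "\<bar>\<rho> u\<bar> \<le> expectation (\<lambda>\<omega>. \<bar>X u \<omega> * X 0 \<omega>\<bar>)"
      using integral_abs_bound[of M "\<lambda>\<omega>. X u \<omega> * X 0 \<omega>"] cov_X[of u 0] by simp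
    also have "\<dots> \<le> \<rho> 0"
      using cov_Cauchy_Schwarz[OF X_in X_in, of u 0] \<rho>_0_nonneg by (simp add: cov_X)
    finally show ?thesis .
  qed
  have "sqrt (2 * (\<rho> 0 - \<rho> u)) \<le> sqrt (4 * \<rho> 0)" using b by (intro real_sqrt_le_mono) (simp add: abs_le_iff)
  then have "sqrt (2 * (\<rho> 0 - \<rho> u)) * sqrt (\<rho> 0) \<le> sqrt (4 * \<rho> 0) * sqrt (\<rho> 0)"
    using \<rho>_0_nonneg by (intro mult_right_mono) auto
  also have "\<dots> = 2 * \<rho> 0" using \<rho>_0_nonneg by (simp add: real_sqrt_mult)
  finally show ?thesis by (simp add: modulus_def)
qed

lemma sampled_L1_tendsto:
  assumes T: "T > 0"
  shows "integrable M (\<lambda>\<omega>. correlogram T X \<tau> \<omega> - sampled T \<tau> n \<omega>)"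
    and "(\<lambda>n. expectation (\<lambda>\<omega>. norm (correlogram T X \<tau> \<omega> - sampled T \<tau> n \<omega>))) \<longlonglongrightarrow> 0"
proof -
  show "integrable M (\<lambda>\<omega>. correlogram T X \<tau> \<omega> - sampled T \<tau> n \<omega>)"
    by (rule sampled_L1_bound[OF T _ modulus_bound]) (use \<rho>_0_nonneg in linarith)
  show "(\<lambda>n. expectation (\<lambda>\<omega>. norm (correlogram T X \<tau> \<omega> - sampled T \<tau> n \<omega>))) \<longlonglongrightarrow> 0"
  proof (rule LIMSEQ_I)
    fix e :: real assume "e > 0"
    then obtain d where d: "d > 0" "\<And>u. \<bar>u\<bar> < d \<Longrightarrow> modulus u < e / 2"
      using modulus_cont[rule_format, of "e / 2"] by auto
    have "(\<lambda>n. T / Suc n) \<longlonglongrightarrow> 0" using LIMSEQ_Suc[OF lim_const_over_n[of T]] by simp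
    from LIMSEQ_D[OF this d(1)] obtain n0 where n0: "\<And>n. n \<ge> n0 \<Longrightarrow> norm (T / Suc n - 0) < d" by blast
    have "norm (expectation (\<lambda>\<omega>. norm (correlogram T X \<tau> \<omega> - sampled T \<tau> n \<omega>)) - 0) < e" if "n \<ge> n0" for n
    proof -
      have h: "T / Suc n > 0" "T / Suc n < d" using T n0[OF that] by auto
      have "modulus (t - grid (T / Suc n) t) \<le> e / 2" for t
      proof (rule less_imp_le[OF d(2)])
        show "\<bar>t - grid (T / Suc n) t\<bar> < d" using grid_bounds(1,2)[OF h(1), of t] h(2) by linarith
      qed
      from sampled_L1_bound(2)[OF T _ this] have "expectation (\<lambda>\<omega>. norm (correlogram T X \<tau> \<omega> - sampled T \<tau> n \<omega>)) \<le> e / 2"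
        using \<open>e > 0\<close> by simp
      moreover have "expectation (\<lambda>\<omega>. norm (correlogram T X \<tau> \<omega> - sampled T \<tau> n \<omega>)) \<ge> 0"
        by (rule Bochner_Integration.integral_nonneg) simp
      ultimately show ?thesis using \<open>e > 0\<close> by simp
    qed
    then show "\<exists>n0. \<forall>n\<ge>n0. norm (expectation (\<lambda>\<omega>. norm (correlogram T X \<tau> \<omega> - sampled T \<tau> n \<omega>)) - 0) < e"
      by blast
  qed
qed

text \<open>By the Gaussian fourth moment formula this is the variance of
  \<open>sampled T \<tau> n\<close>; its limit is \<sigma>^2(\<tau>).\<close>

definition sampled_variance :: "real \<Rightarrow> real \<Rightarrow> nat \<Rightarrow> real" where
  "sampled_variance T \<tau> n = (1 / Suc n)\<^sup>2 * (\<Sum>i<Suc n. \<Sum>j<Suc n.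
    (\<lambda>u. (\<rho> u)\<^sup>2 + \<rho> (u + \<tau>) * \<rho> (u - \<tau>)) (real i * (T / Suc n) - real j * (T / Suc n)))"

lemma sampled_variance_tendsto:
  assumes T: "T > 0"
  shows "sampled_variance T \<tau> \<longlonglongrightarrow>
    2 / T\<^sup>2 * (\<integral>u\<in>{0..T}. (T - u) * ((\<rho> u)\<^sup>2 + \<rho> (u + \<tau>) * \<rho> (u - \<tau>)) \<partial>lborel)"
  unfolding sampled_variance_def
proof (rule mean_double_sum_tendsto[OF _ _ T])
  fix u
  have *: "- u + \<tau> = - (u - \<tau>)" "- u - \<tau> = - (u + \<tau>)" by simp_all
  show "(\<rho> (- u))\<^sup>2 + \<rho> (- u + \<tau>) * \<rho> (- u - \<tau>) = (\<rho> u)\<^sup>2 + \<rho> (u + \<tau>) * \<rho> (u - \<tau>)"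
    unfolding * \<rho>_even by (simp only: mult.commute)
next
  have c: "continuous_on UNIV (\<lambda>u. \<rho> (u + a))" for a
    by (rule continuous_on_compose2[OF cont]) (auto intro!: continuous_on_add continuous_on_id continuous_on_const)
  show "continuous_on UNIV (\<lambda>u. (\<rho> u)\<^sup>2 + \<rho> (u + \<tau>) * \<rho> (u - \<tau>))"
    using c[of \<tau>] c[of "- \<tau>"] cont by (intro continuous_on_add continuous_on_power continuous_on_mult) simp_all
qed

lemma sampled_exp_bound:
  assumes "2 * t\<^sup>2 * sampled_variance T \<tau> n \<le> s\<^sup>2" "0 \<le> s" "s < 1"
  shows "(\<integral>\<^sup>+\<omega>. ennreal (exp (t * (sampled T \<tau> n \<omega> - \<rho> \<tau>))) \<partial>M) \<le> ennreal ((1 - s) powr (- 1 / 2) * exp (- s / 2))"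
proof -
  let ?h = "T / Suc n"
  let ?U = "\<lambda>i. X (real i * ?h + \<tau>)" and ?V = "\<lambda>i. X (real i * ?h)"
  have "(\<Sum>i<Suc n. \<Sum>j<Suc n. cov (?U i) (?U j) * cov (?V i) (?V j) + cov (?U i) (?V j) * cov (?V i) (?U j))
     = (\<Sum>i<Suc n. \<Sum>j<Suc n. (\<lambda>u. (\<rho> u)\<^sup>2 + \<rho> (u + \<tau>) * \<rho> (u - \<tau>)) (real i * ?h - real j * ?h))"
    unfolding cov_X by (intro sum.cong refl) (simp add: power2_eq_square algebra_simps)
  then have v: "2 * t\<^sup>2 * ((1 / Suc n)\<^sup>2 * (\<Sum>i<Suc n. \<Sum>j<Suc n. cov (?U i) (?U j) * cov (?V i) (?V j) + cov (?U i) (?V j) * cov (?V i) (?U j))) \<le> s\<^sup>2"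
    using assms(1) unfolding sampled_variance_def by (simp only:)
  have m: "(1 / Suc n) * (\<Sum>i<Suc n. cov (?U i) (?V i)) = \<rho> \<tau>" by (simp add: cov_X)
  from bilinear_exp_bound[where U = ?U and V = ?V and N = "Suc n", OF X_in X_in v assms(2,3)]
  show ?thesis unfolding m sampled_def .
qed

text \<open>Convergence in L^1 provides an almost surely convergent subsequence, along which Fatou's
  lemma applies. Strictness in \<open>var\<close> lets the finite sums satisfy the same inequality
  eventually, as their variances merely converge.\<close>

lemma correlogram_exp_bound_strict:
  assumes T: "T > 0"
    and var: "2 * t\<^sup>2 * (2 / T\<^sup>2 * (\<integral>u\<in>{0..T}. (T - u) * ((\<rho> u)\<^sup>2 + \<rho> (u + \<tau>) * \<rho> (u - \<tau>)) \<partial>lborel)) < s\<^sup>2"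
    and s: "0 \<le> s" "s < 1"
  shows "(\<integral>\<^sup>+\<omega>. ennreal (exp (t * (correlogram T X \<tau> \<omega> - \<rho> \<tau>))) \<partial>M) \<le> ennreal ((1 - s) powr (- 1 / 2) * exp (- s / 2))"
    (is "_ \<le> ?L")
proof -
  obtain r where r: "strict_mono r"
    and lim: "AE \<omega> in M. (\<lambda>n. correlogram T X \<tau> \<omega> - sampled T \<tau> (r n) \<omega>) \<longlonglongrightarrow> 0"
    using tendsto_L1_AE_subseq[OF sampled_L1_tendsto[OF T, where \<tau> = \<tau>]] by blast
  have [measurable]: "sampled T \<tau> n \<in> borel_measurable M" for n unfolding sampled_def by measurable
  have "(\<integral>\<^sup>+\<omega>. ennreal (exp (t * (correlogram T X \<tau> \<omega> - \<rho> \<tau>))) \<partial>M)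
      = (\<integral>\<^sup>+\<omega>. liminf (\<lambda>n. ennreal (exp (t * (sampled T \<tau> (r n) \<omega> - \<rho> \<tau>)))) \<partial>M)"
  proof (rule nn_integral_cong_AE)
    show "AE \<omega> in M. ennreal (exp (t * (correlogram T X \<tau> \<omega> - \<rho> \<tau>))) = liminf (\<lambda>n. ennreal (exp (t * (sampled T \<tau> (r n) \<omega> - \<rho> \<tau>))))"
      using lim
    proof eventually_elim
      case (elim \<omega>)
      have "(\<lambda>n. sampled T \<tau> (r n) \<omega>) \<longlonglongrightarrow> correlogram T X \<tau> \<omega>"
        using tendsto_diff[OF tendsto_const elim, of "correlogram T X \<tau> \<omega>"] by simp
      then have "(\<lambda>n. ennreal (exp (t * (sampled T \<tau> (r n) \<omega> - \<rho> \<tau>)))) \<longlonglongrightarrow> ennreal (exp (t * (correlogram T X \<tau> \<omega> - \<rho> \<tau>)))"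
        by (intro tendsto_ennrealI tendsto_exp tendsto_mult tendsto_diff tendsto_const)
      then show ?case by (rule lim_imp_Liminf[OF sequentially_bot, symmetric])
    qed
  qed
  also have "\<dots> \<le> liminf (\<lambda>n. \<integral>\<^sup>+\<omega>. ennreal (exp (t * (sampled T \<tau> (r n) \<omega> - \<rho> \<tau>))) \<partial>M)"
    by (rule nn_integral_liminf) measurable
  also have "\<dots> \<le> liminf (\<lambda>n::nat. ?L)"
  proof (rule Liminf_mono)
    have "(\<lambda>n. 2 * t\<^sup>2 * sampled_variance T \<tau> n) \<longlonglongrightarrow> 2 * t\<^sup>2 * (2 / T\<^sup>2 * (\<integral>u\<in>{0..T}. (T - u) * ((\<rho> u)\<^sup>2 + \<rho> (u + \<tau>) * \<rho> (u - \<tau>)) \<partial>lborel))"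
      by (intro tendsto_mult tendsto_const sampled_variance_tendsto[OF T])
    then have "eventually (\<lambda>n. 2 * t\<^sup>2 * sampled_variance T \<tau> n < s\<^sup>2) sequentially"
      by (rule order_tendstoD(2)) (rule var)
    then have "eventually (\<lambda>n. 2 * t\<^sup>2 * sampled_variance T \<tau> (r n) < s\<^sup>2) sequentially"
      by (rule eventually_subseq[OF r])
    then show "\<forall>\<^sub>F n in sequentially. (\<integral>\<^sup>+\<omega>. ennreal (exp (t * (sampled T \<tau> (r n) \<omega> - \<rho> \<tau>))) \<partial>M) \<le> ?L"
      by eventually_elim (intro sampled_exp_bound s less_imp_le)
  qed
  also have "\<dots> = ?L" by (simp add: Liminf_const)
  finally show ?thesis .
qed

text \<open>Equality in \<open>var\<close> is reached by raising s slightly: \<open>s' n\<close>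
  decreases to s, stays below (1 + s) / 2 or equal to it, and the right side is continuous in s. The
  boundary case s = 0 is included and is used for zero variance.\<close>

lemma correlogram_exp_bound:
  assumes T: "T > 0"
    and var: "2 * t\<^sup>2 * (2 / T\<^sup>2 * (\<integral>u\<in>{0..T}. (T - u) * ((\<rho> u)\<^sup>2 + \<rho> (u + \<tau>) * \<rho> (u - \<tau>)) \<partial>lborel)) \<le> s\<^sup>2"
    and s: "0 \<le> s" "s < 1"
  shows "(\<integral>\<^sup>+\<omega>. ennreal (exp (t * (correlogram T X \<tau> \<omega> - \<rho> \<tau>))) \<partial>M) \<le> ennreal ((1 - s) powr (- 1 / 2) * exp (- s / 2))"
proof -
  define q where "q = (1 - s) / 2"
  define s' where "s' = (\<lambda>n. s + q / real (Suc n))"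
  have s': "s < s' n" "s' n < 1" for n
  proof -
    show "s < s' n" using s by (simp add: s'_def q_def)
    have "q / real (Suc n) \<le> q / 1" using s unfolding q_def by (intro divide_left_mono) auto
    then have "s' n \<le> s + q" unfolding s'_def by simp
    also have "s + q < 1" using s unfolding q_def by (simp add: field_simps)
    finally show "s' n < 1" .
  qed
  have lim: "s' \<longlonglongrightarrow> s"
    unfolding s'_def using tendsto_add[OF tendsto_const LIMSEQ_Suc[OF lim_const_over_n[of q]], of s] by simp
  have "(\<lambda>n. ennreal ((1 - s' n) powr (- 1 / 2) * exp (- s' n / 2))) \<longlonglongrightarrow> ennreal ((1 - s) powr (- 1 / 2) * exp (- s / 2))"
    using s by (intro tendsto_ennrealI tendsto_mult tendsto_powr tendsto_exp tendsto_diff tendsto_divide tendsto_minus tendsto_const lim) auto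
  moreover have "(\<integral>\<^sup>+\<omega>. ennreal (exp (t * (correlogram T X \<tau> \<omega> - \<rho> \<tau>))) \<partial>M) \<le> ennreal ((1 - s' n) powr (- 1 / 2) * exp (- s' n / 2))" for n
  proof (rule correlogram_exp_bound_strict[OF T])
    have "s\<^sup>2 < (s' n)\<^sup>2" using s s'(1)[of n] by (intro power_strict_mono) auto
    with var show "2 * t\<^sup>2 * (2 / T\<^sup>2 * (\<integral>u\<in>{0..T}. (T - u) * ((\<rho> u)\<^sup>2 + \<rho> (u + \<tau>) * \<rho> (u - \<tau>)) \<partial>lborel)) < (s' n)\<^sup>2"
      by linarith
    show "0 \<le> s' n" using s s'(1)[of n] by linarith
    show "s' n < 1" by (rule s'(2))
  qed
  ultimately show ?thesis by (rule LIMSEQ_le_const[OF _ exI, rule_format])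
qed

lemma correlogram_measurable: "(\<lambda>(\<tau>, \<omega>). correlogram T X \<tau> \<omega>) \<in> borel_measurable (lborel \<Otimes>\<^sub>M M)"
proof -
  have "(\<lambda>(\<tau>, \<omega>). (1 / T) * (\<integral>t. indicator {0..T} t * (X (t + \<tau>) \<omega> * X t \<omega>) \<partial>lborel)) \<in> borel_measurable (lborel \<Otimes>\<^sub>M M)"
    by measurable
  then show ?thesis by (simp add: correlogram_def set_lebesgue_integral_def)
qed

lemma correlogram_measurable' [measurable]: "correlogram T X \<tau> \<in> borel_measurable M"
  using measurable_Pair2[OF correlogram_measurable, of \<tau>] by simp

text \<open>The variance condition depends on t only through its square, so it holds for t and - t
  alike; adding both bounds is the origin of the factor 2 in the theorem.\<close>

lemma correlogram_exp_abs_bound: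
  assumes T: "T > 0"
    and var: "2 * t\<^sup>2 * (2 / T\<^sup>2 * (\<integral>u\<in>{0..T}. (T - u) * ((\<rho> u)\<^sup>2 + \<rho> (u + \<tau>) * \<rho> (u - \<tau>)) \<partial>lborel)) \<le> s\<^sup>2"
    and s: "0 \<le> s" "s < 1"
  shows "(\<integral>\<^sup>+\<omega>. ennreal (exp (t * \<bar>correlogram T X \<tau> \<omega> - \<rho> \<tau>\<bar>)) \<partial>M) \<le> ennreal (2 * ((1 - s) powr (- 1 / 2) * exp (- s / 2)))"
proof -
  let ?Y = "\<lambda>\<omega>. correlogram T X \<tau> \<omega> - \<rho> \<tau>"
  have "(\<integral>\<^sup>+\<omega>. ennreal (exp (t * \<bar>?Y \<omega>\<bar>)) \<partial>M) \<le> (\<integral>\<^sup>+\<omega>. ennreal (exp (t * ?Y \<omega>)) + ennreal (exp (- t * ?Y \<omega>)) \<partial>M)"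
  proof (rule nn_integral_mono)
    fix \<omega>
    have "exp (t * \<bar>?Y \<omega>\<bar>) \<le> exp (t * ?Y \<omega>) + exp (- t * ?Y \<omega>)"
    proof (cases "?Y \<omega> \<ge> 0")
      case False
      then have "t * \<bar>?Y \<omega>\<bar> = - t * ?Y \<omega>" by (simp add: algebra_simps)
      then show ?thesis by (simp only: le_add_same_cancel2 exp_ge_zero)
    qed simp
    then show "ennreal (exp (t * \<bar>?Y \<omega>\<bar>)) \<le> ennreal (exp (t * ?Y \<omega>)) + ennreal (exp (- t * ?Y \<omega>))"
      by (simp add: ennreal_plus[symmetric] del: ennreal_plus)
  qed
  also have "\<dots> = (\<integral>\<^sup>+\<omega>. ennreal (exp (t * ?Y \<omega>)) \<partial>M) + (\<integral>\<^sup>+\<omega>. ennreal (exp (- t * ?Y \<omega>)) \<partial>M)"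
    by (rule nn_integral_add) measurable
  also have "\<dots> \<le> ennreal ((1 - s) powr (- 1 / 2) * exp (- s / 2)) + ennreal ((1 - s) powr (- 1 / 2) * exp (- s / 2))"
    by (intro add_mono correlogram_exp_bound T s) (use var in simp_all)
  also have "\<dots> = ennreal (2 * ((1 - s) powr (- 1 / 2) * exp (- s / 2)))"
    by (simp add: ennreal_plus[symmetric] del: ennreal_plus)
  finally show ?thesis .
qed

end

section \<open>The deviation inequality\<close>

text \<open>Bernoulli's inequality for real exponents. With l = ln y it combines exp u \<ge> 1 + u
  at u = (q - 1) l and at u = - l.\<close>

lemma powr_ge_tangent:
  fixes y q :: real
  assumes "y > 0" "q \<ge> 1"
  shows "y powr q \<ge> 1 + q * (y - 1)"
proof -
  define l where "l = ln y"
  have y: "exp l = y" using assms by (simp add: l_def)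
  have yq: "exp (q * l) = y powr q" using assms by (simp add: powr_def l_def)
  have "exp l * (1 + (q - 1) * l) \<le> exp l * exp ((q - 1) * l)"
    by (intro mult_left_mono exp_ge_add_one_self) simp
  also have "\<dots> = exp (q * l)" by (simp add: exp_add[symmetric] algebra_simps)
  finally have 1: "y * (1 + (q - 1) * l) \<le> y powr q" unfolding y yq .
  have "exp l * (1 + - l) \<le> exp l * exp (- l)"
    by (intro mult_left_mono exp_ge_add_one_self) simp
  also have "\<dots> = 1" by (simp add: exp_add[symmetric])
  finally have "y * (1 - l) \<le> 1" unfolding y by simp
  then have "(q - 1) * (y * (1 - l)) \<le> (q - 1) * 1" using assms by (intro mult_left_mono) auto
  with 1 show ?thesis by (simp add: algebra_simps)
qed

text \<open>Between the two sides lies e^\<alpha> z^\<alpha>: from above by ln z \<le> z - 1, from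
  below by Bernoulli's inequality for z^p with exponent \<alpha> / p, which is at least 1. At z = 0
  the right side is nonpositive for the same reason.\<close>

lemma exp_ge_powr_tangent:
  fixes z \<alpha> p :: real
  assumes "z \<ge> 0" "p > 0" "\<alpha> \<ge> p"
  shows "exp (\<alpha> * z) \<ge> exp \<alpha> * (1 + \<alpha> / p * (z powr p - 1))"
proof (cases "z = 0")
  case True
  have "1 - \<alpha> / p \<le> 0" using assms by simp
  then have "exp \<alpha> * (1 - \<alpha> / p) \<le> 0" by (simp add: mult_nonneg_nonpos)
  then show ?thesis using True by simp
next
  case False
  then have z: "z > 0" using assms by simp
  have "1 + \<alpha> / p * (z powr p - 1) \<le> (z powr p) powr (\<alpha> / p)"
    by (rule powr_ge_tangent) (use z assms in auto)
  also have "\<dots> = z powr \<alpha>" using assms by (simp add: powr_powr)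
  also have "\<dots> = exp (\<alpha> * ln z)" using z by (simp add: powr_def)
  also have "\<dots> \<le> exp (\<alpha> * (z - 1))"
    using ln_le_minus_one[OF z] assms by simp
  finally have "exp \<alpha> * (1 + \<alpha> / p * (z powr p - 1)) \<le> exp \<alpha> * exp (\<alpha> * (z - 1))"
    by (intro mult_left_mono) auto
  also have "\<dots> = exp (\<alpha> * z)" by (simp add: exp_add[symmetric] algebra_simps)
  finally show ?thesis .
qed

text \<open>Setting the derivative of - ln (1 - s) / 2 - s / 2 - s x / sqrt 2 to zero gives 1 / (1 -
  s) = 1 + sqrt 2 x. Hence the square root in the bound, and the two exponents add up to s / 2 +
  \<alpha> = x / sqrt 2.\<close>

lemma optimal_exponent:
  fixes x :: real
  assumes x: "x > 0"
  defines "s \<equiv> sqrt 2 * x / (1 + sqrt 2 * x)" and "\<alpha> \<equiv> x\<^sup>2 / (1 + sqrt 2 * x)"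
  shows "0 \<le> s" "s < 1" "2 * \<alpha>\<^sup>2 = s\<^sup>2 * x\<^sup>2"
    "(1 - s) powr (- 1 / 2) * exp (- s / 2) * exp (- \<alpha>) = sqrt (1 + sqrt 2 * x) * exp (- (x / sqrt 2))"
proof -
  define r where "r = sqrt 2"
  have r: "r > 0" "r * r = 2" by (simp_all add: r_def)
  define D where "D = 1 + r * x"
  have D: "D > 0" using x r by (simp add: D_def add_pos_pos)
  have s: "s = r * x / D" and a: "\<alpha> = x\<^sup>2 / D" by (simp_all add: s_def \<alpha>_def r_def D_def)
  show "0 \<le> s" unfolding s using x r D by simp
  show "s < 1" unfolding s using D by (simp add: D_def)
  show "2 * \<alpha>\<^sup>2 = s\<^sup>2 * x\<^sup>2"
    unfolding s a using r by (simp add: power_divide power_mult_distrib power2_eq_square)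
  have "1 - s = 1 / D" unfolding s using D by (simp add: field_simps) (simp add: D_def)
  then have "(1 - s) powr (- 1 / 2) = (1 / D) powr (- 1 / 2)" by (simp only:)
  also have "\<dots> = sqrt D" using D by (simp add: powr_minus powr_divide powr_half_sqrt)
  finally have 1: "(1 - s) powr (- 1 / 2) = sqrt D" .
  have "s / 2 + \<alpha> = x / r"
  proof -
    have "s / 2 + \<alpha> = (x * (r * D)) / (2 * D)"
      unfolding s a using D by (simp add: field_simps) (simp add: D_def r(2) power2_eq_square algebra_simps)
    also have "\<dots> = x * r / 2" using D by simp
    also have "\<dots> = x / r" using r by (simp add: field_simps)
    finally show ?thesis .
  qed
  then have "exp (- s / 2) * exp (- \<alpha>) = exp (- (x / r))"
    by (simp add: exp_add[symmetric])
  then show "(1 - s) powr (- 1 / 2) * exp (- s / 2) * exp (- \<alpha>) = sqrt (1 + sqrt 2 * x) * exp (- (x / sqrt 2))"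
    unfolding 1 mult.assoc by (simp add: D_def r_def)
qed

text \<open>Clearing the denominator and completing the square turns the claim into (x - p / sqrt
  2)^2 \<ge> (p / 2 + 1) p, which is the assumption squared.\<close>

lemma optimal_exponent_ge:
  fixes x p :: real
  assumes p: "p \<ge> 1" and x: "x \<ge> p / sqrt 2 + sqrt ((p / 2 + 1) * p)"
  shows "p \<le> x\<^sup>2 / (1 + sqrt 2 * x)" "x > 0"
proof -
  define r where "r = sqrt 2"
  have r: "r > 0" "r * r = 2" by (simp_all add: r_def)
  have c: "(p / 2 + 1) * p \<ge> 0" using p by simp
  have pr: "p / r = r * p / 2" using r by (simp add: field_simps)
  have x': "x - r * p / 2 \<ge> sqrt ((p / 2 + 1) * p)" using x pr unfolding r_def by simp
  have "(sqrt ((p / 2 + 1) * p))\<^sup>2 \<le> (x - r * p / 2)\<^sup>2"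
    by (rule power_mono[OF x']) (use c in simp)
  then have "(p / 2 + 1) * p \<le> (x - r * p / 2)\<^sup>2" using c by simp
  also have "(x - r * p / 2)\<^sup>2 = x\<^sup>2 - r * p * x + (r * r) * p\<^sup>2 / 4"
    by (simp add: power2_eq_square field_simps)
  finally have *: "p * (1 + r * x) \<le> x\<^sup>2" unfolding r(2) by (simp add: power2_eq_square algebra_simps)
  have "p / r > 0" using p r by simp
  moreover have "sqrt ((p / 2 + 1) * p) \<ge> 0" using c by simp
  ultimately show x0: "x > 0" using x unfolding r_def by linarith
  have "1 + r * x > 0" using x0 r by (simp add: add_pos_pos)
  then show "p \<le> x\<^sup>2 / (1 + sqrt 2 * x)" using * unfolding r_def by (simp add: pos_le_divide_eq)
qed

section \<open>From pointwise exponential moments to the L^p deviation\<close>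

context stationary_gaussian
begin

text \<open>With variance zero the exponential bound holds for every t with s = 0 and right side 2.
  Since y \<le> exp (t y) / t for t > 0, the mean deviation is at most 2 / t; t = 2 / e makes this
  e.\<close>

lemma correlogram_degenerate:
  assumes T: "T > 0"
    and var: "2 / T\<^sup>2 * (\<integral>u\<in>{0..T}. (T - u) * ((\<rho> u)\<^sup>2 + \<rho> (u + \<tau>) * \<rho> (u - \<tau>)) \<partial>lborel) = 0"
  shows "AE \<omega> in M. correlogram T X \<tau> \<omega> = \<rho> \<tau>"
proof -
  let ?D = "\<lambda>\<omega>. \<bar>correlogram T X \<tau> \<omega> - \<rho> \<tau>\<bar>"
  have "(\<integral>\<^sup>+\<omega>. ennreal (?D \<omega>) \<partial>M) \<le> 0"
  proof (rule ennreal_le_epsilon)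
    fix e :: real assume e: "0 < e"
    have v0: "2 * (2 / e)\<^sup>2 * (2 / T\<^sup>2 * (\<integral>u\<in>{0..T}. (T - u) * ((\<rho> u)\<^sup>2 + \<rho> (u + \<tau>) * \<rho> (u - \<tau>)) \<partial>lborel)) \<le> 0\<^sup>2"
      unfolding var by simp
    have "(\<integral>\<^sup>+\<omega>. ennreal (?D \<omega>) \<partial>M) \<le> (\<integral>\<^sup>+\<omega>. ennreal (e / 2) * ennreal (exp (2 / e * ?D \<omega>)) \<partial>M)"
    proof (rule nn_integral_mono)
      fix \<omega>
      have "2 / e * ?D \<omega> \<le> exp (2 / e * ?D \<omega>)"
        using exp_ge_add_one_self[of "2 / e * ?D \<omega>"] by linarith
      then have "e / 2 * (2 / e * ?D \<omega>) \<le> e / 2 * exp (2 / e * ?D \<omega>)"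
        using e by (intro mult_left_mono) auto
      moreover have "e / 2 * (2 / e * ?D \<omega>) = ?D \<omega>" using e by simp
      ultimately have "?D \<omega> \<le> e / 2 * exp (2 / e * ?D \<omega>)" by linarith
      then show "ennreal (?D \<omega>) \<le> ennreal (e / 2) * ennreal (exp (2 / e * ?D \<omega>))"
        using e by (subst ennreal_mult[symmetric]) (auto intro: ennreal_leI)
    qed
    also have "\<dots> = ennreal (e / 2) * (\<integral>\<^sup>+\<omega>. ennreal (exp (2 / e * ?D \<omega>)) \<partial>M)"
      by (rule nn_integral_cmult) measurable
    also have "\<dots> \<le> ennreal (e / 2) * ennreal (2 * ((1 - 0) powr (- 1 / 2) * exp (- 0 / 2)))"
      by (intro mult_left_mono correlogram_exp_abs_bound[OF T v0]) simp_all
    also have "\<dots> = 0 + ennreal e" using e by (subst ennreal_mult[symmetric]) simp_all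
    finally show "(\<integral>\<^sup>+\<omega>. ennreal (?D \<omega>) \<partial>M) \<le> 0 + ennreal e" .
  qed
  then have "AE \<omega> in M. ennreal (?D \<omega>) = 0"
    by (subst (asm) le_zero_eq, subst (asm) nn_integral_0_iff_AE) auto
  then show ?thesis by eventually_elim simp
qed

theorem correlogram_deviation:
  assumes p: "p \<ge> 1" and T: "0 < T" and C0: "C_const p T A \<rho> > 0"
    and \<epsilon>: "\<epsilon> \<ge> (p / sqrt 2 + sqrt ((p / 2 + 1) * p)) powr p * C_const p T A \<rho>"
  shows "measure M {\<omega> \<in> space M.
            (\<integral>\<^sup>+\<tau>\<in>{0..A}. ennreal (\<bar>correlogram T X \<tau> \<omega> - \<rho> \<tau>\<bar> powr p) \<partial>lborel) > ennreal \<epsilon>}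
         \<le> 2 * sqrt (1 + sqrt 2 * \<epsilon> powr (1 / p) / C_const p T A \<rho> powr (1 / p))
             * exp (- (\<epsilon> powr (1 / p) / (sqrt 2 * C_const p T A \<rho> powr (1 / p))))"
proof -
  interpret P: pair_sigma_finite lborel M ..
  define C where "C = C_const p T A \<rho>"
  define v where "v = (\<lambda>\<tau>. 2 / T\<^sup>2 * (\<integral>u\<in>{0..T}. (T - u) * ((\<rho> u)\<^sup>2 + \<rho> (u + \<tau>) * \<rho> (u - \<tau>)) \<partial>lborel))"
  define g where "g = (\<lambda>\<tau>. indicator {0..A} \<tau> * v \<tau> powr (p / 2))"
  define D where "D = (\<lambda>\<tau> \<omega>. \<bar>correlogram T X \<tau> \<omega> - \<rho> \<tau>\<bar>)"
  have C: "C = (\<integral>\<tau>. g \<tau> \<partial>lborel)"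
    unfolding C_def C_const_def g_def v_def set_lebesgue_integral_def by simp
  have Cpos: "C > 0" using C0 by (simp add: C_def)
  \<comment> \<open>The integral of a function that is not integrable is 0 by convention, so
    positivity of C forces integrability.\<close>
  have gi: "integrable lborel g" using Cpos not_integrable_integral_eq[of lborel g] unfolding C by force
  have [measurable]: "g \<in> borel_measurable lborel" using gi by (rule borel_measurable_integrable)
  have gnn: "g \<tau> \<ge> 0" for \<tau> by (simp add: g_def)
  have gC: "(\<integral>\<^sup>+\<tau>. ennreal (g \<tau>) \<partial>lborel) = ennreal C"
    unfolding C by (rule nn_integral_eq_integral[OF gi]) (simp add: gnn)
  define x where "x = (\<epsilon> / C) powr (1 / p)"
  define x0 where "x0 = p / sqrt 2 + sqrt ((p / 2 + 1) * p)"
  have x0: "x0 > 0" unfolding x0_def using p by (intro add_pos_nonneg) auto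
  have \<epsilon>pos: "\<epsilon> > 0"
  proof -
    have "0 < x0 powr p * C" using x0 Cpos by simp
    also have "\<dots> \<le> \<epsilon>" using \<epsilon> unfolding C_def x0_def .
    finally show ?thesis .
  qed
  have "x0 powr p \<le> \<epsilon> / C" using \<epsilon> Cpos unfolding C_def x0_def by (simp add: pos_le_divide_eq)
  then have "(x0 powr p) powr (1 / p) \<le> x" unfolding x_def using p by (intro powr_mono2) auto
  then have xge: "x \<ge> x0" using p x0 by (simp add: powr_powr)
  have xpos: "x > 0" using xge x0 by linarith
  have xp: "x powr p = \<epsilon> / C" unfolding x_def using p \<epsilon>pos Cpos by (simp add: powr_powr)
  have xeq: "x = \<epsilon> powr (1 / p) / C powr (1 / p)"
    unfolding x_def using \<epsilon>pos Cpos by (simp add: powr_divide)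
  define s where "s = sqrt 2 * x / (1 + sqrt 2 * x)"
  define \<alpha> where "\<alpha> = x\<^sup>2 / (1 + sqrt 2 * x)"
  note opt = optimal_exponent[OF xpos, folded s_def \<alpha>_def]
  have \<alpha>p: "\<alpha> \<ge> p" unfolding \<alpha>_def by (rule optimal_exponent_ge[OF p]) (use xge x0_def in simp)
  have \<alpha>pos: "\<alpha> > 0" using \<alpha>p p by linarith
  define L where "L = (1 - s) powr (- 1 / 2) * exp (- s / 2)"
  have Lnn: "L \<ge> 0" by (simp add: L_def)
  \<comment> \<open>Written as a power of \<open>g\<close>, it inherits measurability from
    \<open>g\<close> and equals the root of \<open>v\<close> wherever \<open>v\<close> is positive
    on [0, A]. In \<open>H\<close> the factor \<open>g\<close> is 0 where \<sigma> is, so the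
    quotient there does no harm.\<close>
  define \<sigma> where "\<sigma> = (\<lambda>\<tau>. g \<tau> powr (1 / p))"
  define H where "H = (\<lambda>\<tau> \<omega>. ennreal (g \<tau>) * ennreal (exp (\<alpha> / (x * \<sigma> \<tau>) * D \<tau> \<omega>)))"
  have [measurable]: "\<rho> \<in> borel_measurable borel" by (rule borel_measurable_continuous_onI[OF cont])
  note [measurable] = correlogram_measurable[of T]
  have Dm [measurable]: "(\<lambda>(\<tau>, \<omega>). D \<tau> \<omega>) \<in> borel_measurable (lborel \<Otimes>\<^sub>M M)"
  proof -
    have "(\<lambda>z. \<bar>(\<lambda>(\<tau>, \<omega>). correlogram T X \<tau> \<omega>) z - \<rho> (fst z)\<bar>) \<in> borel_measurable (lborel \<Otimes>\<^sub>M M)"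
      by measurable
    then show ?thesis by (simp add: D_def case_prod_beta')
  qed
  have \<sigma>m [measurable]: "\<sigma> \<in> borel_measurable lborel" unfolding \<sigma>_def by measurable
  have Hm [measurable]: "(\<lambda>(\<tau>, \<omega>). H \<tau> \<omega>) \<in> borel_measurable (lborel \<Otimes>\<^sub>M M)"
    unfolding H_def by measurable
  have Hbound: "(\<integral>\<^sup>+\<omega>. H \<tau> \<omega> \<partial>M) \<le> ennreal (g \<tau>) * ennreal (2 * L)" for \<tau>
  proof (cases "g \<tau> = 0")
    case True then show ?thesis by (simp add: H_def)
  next
    case False
    then have \<tau>: "\<tau> \<in> {0..A}" and gpos: "g \<tau> > 0" and gv: "g \<tau> = v \<tau> powr (p / 2)"
      using gnn[of \<tau>] by (auto simp: g_def indicator_def split: if_splits)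
    have \<sigma>pos: "\<sigma> \<tau> > 0" using gpos by (simp add: \<sigma>_def)
    txt \<open>Nonnegativity of $v(\tau)$ is not needed: for $v(\tau)<0$ the real power in $g$ is a junk value,
      but then the exponential bound holds for every $t$.\<close>
    have var: "2 * (\<alpha> / (x * \<sigma> \<tau>))\<^sup>2 * v \<tau> \<le> s\<^sup>2"
    proof (cases "v \<tau> > 0")
      case True
      have "\<sigma> \<tau> = v \<tau> powr (1 / 2)" unfolding \<sigma>_def gv using p by (simp add: powr_powr)
      then have "(\<sigma> \<tau>)\<^sup>2 = v \<tau>" using True by (simp add: powr_half_sqrt)
      then have "2 * (\<alpha> / (x * \<sigma> \<tau>))\<^sup>2 * v \<tau> = 2 * \<alpha>\<^sup>2 / x\<^sup>2"
        using True by (simp add: power_divide power_mult_distrib)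
      also have "\<dots> = s\<^sup>2" unfolding opt(3) using xpos by simp
      finally show ?thesis by simp
    next
      case False
      then have "2 * (\<alpha> / (x * \<sigma> \<tau>))\<^sup>2 * v \<tau> \<le> 0" by (intro mult_nonneg_nonpos) auto
      also have "0 \<le> s\<^sup>2" by simp
      finally show ?thesis .
    qed
    have [measurable]: "D \<tau> \<in> borel_measurable M" unfolding D_def by measurable
    have "(\<integral>\<^sup>+\<omega>. H \<tau> \<omega> \<partial>M) = ennreal (g \<tau>) * (\<integral>\<^sup>+\<omega>. ennreal (exp (\<alpha> / (x * \<sigma> \<tau>) * D \<tau> \<omega>)) \<partial>M)"
      unfolding H_def by (rule nn_integral_cmult) measurable
    also have "\<dots> \<le> ennreal (g \<tau>) * ennreal (2 * L)"
      unfolding D_def L_def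
      by (intro mult_left_mono correlogram_exp_abs_bound[OF T _ opt(1,2)]) (use var v_def in simp_all)
    finally show ?thesis .
  qed
  have "(\<integral>\<^sup>+\<omega>. (\<integral>\<^sup>+\<tau>. H \<tau> \<omega> \<partial>lborel) \<partial>M) = (\<integral>\<^sup>+\<tau>. (\<integral>\<^sup>+\<omega>. H \<tau> \<omega> \<partial>M) \<partial>lborel)"
    by (rule P.Fubini') measurable
  also have "\<dots> \<le> (\<integral>\<^sup>+\<tau>. ennreal (g \<tau>) * ennreal (2 * L) \<partial>lborel)"
    by (intro nn_integral_mono Hbound)
  also have "\<dots> = ennreal C * ennreal (2 * L)"
    by (subst nn_integral_multc) (simp_all add: gC)
  finally have EH: "(\<integral>\<^sup>+\<omega>. (\<integral>\<^sup>+\<tau>. H \<tau> \<omega> \<partial>lborel) \<partial>M) \<le> ennreal (C * (2 * L))"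
    using Cpos Lnn by (simp add: ennreal_mult)
  \<comment> \<open>Where \<open>g\<close> vanishes the tangent inequality controls nothing, so D
    has to vanish too. This is known for each \<tau> almost surely; the product structure is used to
    exchange the two quantifiers.\<close>
  define Q where "Q = (\<lambda>\<tau> \<omega>. \<tau> \<in> {0..A} \<longrightarrow> g \<tau> = 0 \<longrightarrow> D \<tau> \<omega> = 0)"
  have "{z \<in> space (lborel \<Otimes>\<^sub>M M). Q (fst z) (snd z)} \<in> sets (lborel \<Otimes>\<^sub>M M)"
    unfolding Q_def by measurable
  note P.AE_commute[OF this]
  moreover have "AE \<tau> in lborel. AE \<omega> in M. Q \<tau> \<omega>"
    unfolding Q_def
    proof (rule AE_I2)
      fix \<tau>
      show "AE \<omega> in M. \<tau> \<in> {0..A} \<longrightarrow> g \<tau> = 0 \<longrightarrow> D \<tau> \<omega> = 0"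
      proof (cases "\<tau> \<in> {0..A} \<and> g \<tau> = 0")
        case True
        then have "v \<tau> = 0" by (auto simp: g_def indicator_def)
        then have "AE \<omega> in M. correlogram T X \<tau> \<omega> = \<rho> \<tau>"
          unfolding v_def by (rule correlogram_degenerate[OF T])
        then show ?thesis by eventually_elim (simp add: D_def)
      qed auto
    qed
  ultimately have degenerate: "AE \<omega> in M. AE \<tau> in lborel. Q \<tau> \<omega>" by simp
  \<comment> \<open>The coefficient of z^p in the tangent inequality.\<close>
  define K where "K = exp \<alpha> * (\<alpha> / p)"
  have Kpos: "K > 0" using \<alpha>pos p by (simp add: K_def)
  \<comment> \<open>The tangent inequality times g = \<sigma>^p, with z^p written out. The negative
    term is moved to the right so that every term is nonnegative and the inequality can be
    integrated in \<open>ennreal\<close>.\<close>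
  have key: "exp \<alpha> * g \<tau> + K / x powr p * (indicator {0..A} \<tau> * D \<tau> \<omega> powr p)
      \<le> g \<tau> * exp (\<alpha> / (x * \<sigma> \<tau>) * D \<tau> \<omega>) + K * g \<tau>"
    if D0: "\<tau> \<in> {0..A} \<longrightarrow> g \<tau> = 0 \<longrightarrow> D \<tau> \<omega> = 0" for \<tau> \<omega>
  proof (cases "g \<tau> = 0")
    case True
    then show ?thesis using D0 by (cases "\<tau> \<in> {0..A}") auto
  next
    case False
    then have \<tau>: "\<tau> \<in> {0..A}" and gpos: "g \<tau> > 0"
      using gnn[of \<tau>] by (auto simp: g_def indicator_def split: if_splits)
    have \<sigma>pos: "\<sigma> \<tau> > 0" using gpos by (simp add: \<sigma>_def)
    have \<sigma>p: "\<sigma> \<tau> powr p = g \<tau>" using gpos p by (simp add: \<sigma>_def powr_powr)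
    define z where "z = D \<tau> \<omega> / (x * \<sigma> \<tau>)"
    have z: "z \<ge> 0" using xpos \<sigma>pos by (simp add: z_def D_def)
    have zp: "z powr p = D \<tau> \<omega> powr p / (x powr p * g \<tau>)"
      unfolding z_def using xpos \<sigma>pos by (simp add: powr_divide powr_mult \<sigma>p D_def)
    have "g \<tau> * (exp \<alpha> * (1 + \<alpha> / p * (z powr p - 1))) \<le> g \<tau> * exp (\<alpha> * z)"
      by (intro mult_left_mono exp_ge_powr_tangent z \<alpha>p gnn) (use p in simp)
    moreover have "g \<tau> * (exp \<alpha> * (1 + \<alpha> / p * (z powr p - 1))) = exp \<alpha> * g \<tau> + K * (g \<tau> * z powr p) - K * g \<tau>"
      by (simp add: K_def algebra_simps)
    moreover have "g \<tau> * z powr p = D \<tau> \<omega> powr p / x powr p" unfolding zp using gpos by simp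
    moreover have "\<alpha> * z = \<alpha> / (x * \<sigma> \<tau>) * D \<tau> \<omega>" by (simp add: z_def)
    ultimately show ?thesis using \<tau> by simp
  qed
  have lower: "AE \<omega> in M. \<omega> \<in> {\<omega> \<in> space M. (\<integral>\<^sup>+\<tau>\<in>{0..A}. ennreal (D \<tau> \<omega> powr p) \<partial>lborel) > ennreal \<epsilon>}
      \<longrightarrow> \<omega> \<in> {\<omega> \<in> space M. 1 \<le> ennreal (1 / (exp \<alpha> * C)) * (\<integral>\<^sup>+\<tau>. H \<tau> \<omega> \<partial>lborel)}"
    using degenerate[unfolded Q_def] AE_space
  proof (eventually_elim, intro impI)
    fix \<omega> assume D0: "AE \<tau> in lborel. \<tau> \<in> {0..A} \<longrightarrow> g \<tau> = 0 \<longrightarrow> D \<tau> \<omega> = 0" and \<omega>: "\<omega> \<in> space M"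
      and "\<omega> \<in> {\<omega> \<in> space M. (\<integral>\<^sup>+\<tau>\<in>{0..A}. ennreal (D \<tau> \<omega> powr p) \<partial>lborel) > ennreal \<epsilon>}"
    then have I: "ennreal \<epsilon> \<le> (\<integral>\<^sup>+\<tau>. ennreal (indicator {0..A} \<tau> * D \<tau> \<omega> powr p) \<partial>lborel)"
      by (auto simp: indicator_mult_ennreal mult.commute intro!: less_imp_le)
    have [measurable]: "(\<lambda>\<tau>. D \<tau> \<omega>) \<in> borel_measurable lborel"
      using measurable_Pair1[OF Dm \<omega>] by simp
    have [measurable]: "(\<lambda>\<tau>. H \<tau> \<omega>) \<in> borel_measurable lborel"
      using measurable_Pair1[OF Hm \<omega>] by simp
    \<comment> \<open>The choice x^p = \<epsilon> / C is made for this equality: at the threshold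
      the power term is worth exactly the \<open>K * C\<close> that stands on the other
      side.\<close>
    have "ennreal (K / x powr p) * ennreal \<epsilon> = ennreal (K * C)"
      using Kpos Cpos \<epsilon>pos unfolding xp by (simp add: ennreal_mult[symmetric])
    then have "ennreal (exp \<alpha> * C) + ennreal (K * C) \<le> ennreal (exp \<alpha>) * ennreal C
        + ennreal (K / x powr p) * (\<integral>\<^sup>+\<tau>. ennreal (indicator {0..A} \<tau> * D \<tau> \<omega> powr p) \<partial>lborel)"
      using mult_left_mono[OF I, of "ennreal (K / x powr p)"] Cpos by (simp add: ennreal_mult)
    also have "\<dots> = (\<integral>\<^sup>+\<tau>. ennreal (exp \<alpha>) * ennreal (g \<tau>)
        + ennreal (K / x powr p) * ennreal (indicator {0..A} \<tau> * D \<tau> \<omega> powr p) \<partial>lborel)"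
      by (simp add: nn_integral_add nn_integral_cmult gC)
    also have "\<dots> \<le> (\<integral>\<^sup>+\<tau>. H \<tau> \<omega> + ennreal K * ennreal (g \<tau>) \<partial>lborel)"
    proof (rule nn_integral_mono_AE)
      show "AE \<tau> in lborel. ennreal (exp \<alpha>) * ennreal (g \<tau>)
        + ennreal (K / x powr p) * ennreal (indicator {0..A} \<tau> * D \<tau> \<omega> powr p) \<le> H \<tau> \<omega> + ennreal K * ennreal (g \<tau>)"
        using D0
      proof eventually_elim
        case (elim \<tau>)
        have "ennreal (exp \<alpha> * g \<tau> + K / x powr p * (indicator {0..A} \<tau> * D \<tau> \<omega> powr p))
            \<le> ennreal (g \<tau> * exp (\<alpha> / (x * \<sigma> \<tau>) * D \<tau> \<omega>) + K * g \<tau>)"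
          by (rule ennreal_leI[OF key[OF elim]])
        then show ?case
          using Kpos gnn[of \<tau>] unfolding H_def
          by (simp add: ennreal_mult[symmetric] ennreal_plus[symmetric] del: ennreal_plus)
      qed
    qed
    also have "\<dots> = (\<integral>\<^sup>+\<tau>. H \<tau> \<omega> \<partial>lborel) + ennreal (K * C)"
      using Kpos Cpos by (simp add: nn_integral_add nn_integral_cmult gC ennreal_mult)
    \<comment> \<open>The common summand \<open>K * C\<close> is finite and may be
      cancelled.\<close>
    finally have "ennreal (exp \<alpha> * C) \<le> (\<integral>\<^sup>+\<tau>. H \<tau> \<omega> \<partial>lborel)"
      by (simp add: add.commute[of _ "ennreal (K * C)"] ennreal_add_left_cancel_le)
    then have "ennreal (1 / (exp \<alpha> * C)) * ennreal (exp \<alpha> * C) \<le> ennreal (1 / (exp \<alpha> * C)) * (\<integral>\<^sup>+\<tau>. H \<tau> \<omega> \<partial>lborel)"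
      by (rule mult_left_mono) simp
    moreover have "ennreal (1 / (exp \<alpha> * C)) * ennreal (exp \<alpha> * C) = 1"
      using Cpos by (simp add: ennreal_mult[symmetric])
    ultimately show "\<omega> \<in> {\<omega> \<in> space M. 1 \<le> ennreal (1 / (exp \<alpha> * C)) * (\<integral>\<^sup>+\<tau>. H \<tau> \<omega> \<partial>lborel)}"
      using \<omega> by simp
  qed
  let ?B = "{\<omega> \<in> space M. (\<integral>\<^sup>+\<tau>\<in>{0..A}. ennreal (D \<tau> \<omega> powr p) \<partial>lborel) > ennreal \<epsilon>}"
  have [measurable]: "(\<lambda>\<omega>. \<integral>\<^sup>+\<tau>. H \<tau> \<omega> \<partial>lborel) \<in> borel_measurable M" by measurable
  have "emeasure M ?B \<le> emeasure M {\<omega> \<in> space M. 1 \<le> ennreal (1 / (exp \<alpha> * C)) * (\<integral>\<^sup>+\<tau>. H \<tau> \<omega> \<partial>lborel)}"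
    by (rule emeasure_mono_AE[OF lower]) measurable
  also have "\<dots> \<le> ennreal (1 / (exp \<alpha> * C)) * (\<integral>\<^sup>+\<omega>. (\<integral>\<^sup>+\<tau>. H \<tau> \<omega> \<partial>lborel) * indicator (space M) \<omega> \<partial>M)"
    by (rule nn_integral_Markov_inequality) measurable
  also have "(\<integral>\<^sup>+\<omega>. (\<integral>\<^sup>+\<tau>. H \<tau> \<omega> \<partial>lborel) * indicator (space M) \<omega> \<partial>M) = (\<integral>\<^sup>+\<omega>. (\<integral>\<^sup>+\<tau>. H \<tau> \<omega> \<partial>lborel) \<partial>M)"
    by (rule nn_integral_cong) simp
  also have "ennreal (1 / (exp \<alpha> * C)) * \<dots> \<le> ennreal (1 / (exp \<alpha> * C)) * ennreal (C * (2 * L))"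
    by (rule mult_left_mono[OF EH]) simp
  \<comment> \<open>C cancels against the normalisation in Markov's inequality, so the bound depends
    on C only through x.\<close>
  also have "\<dots> = ennreal (2 * (L * exp (- \<alpha>)))"
    using Cpos Lnn by (subst ennreal_mult[symmetric]) (simp_all add: exp_minus field_simps)
  finally have "measure M ?B \<le> 2 * (L * exp (- \<alpha>))"
    using Lnn by (simp add: emeasure_eq_measure)
  also have "L * exp (- \<alpha>) = sqrt (1 + sqrt 2 * x) * exp (- (x / sqrt 2))"
    unfolding L_def by (rule opt(4))
  finally show ?thesis unfolding D_def xeq C_def by (simp add: mult.commute[of "sqrt 2"] mult.assoc)
qed

end

theorem theorem3:
  fixes M :: "'a measure" and X :: "real \<Rightarrow> 'a \<Rightarrow> real" and \<rho> :: "real \<Rightarrow> real"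
    and p T A \<epsilon> :: real
  assumes "prob_space M"
    and "p \<ge> 1" and "0 < T" and "0 < A"
    and "measurable_process M X"
    and "stationary_process M X"
    and "gaussian_process M X"
    and "\<And>t. prob_space.expectation M (X t) = 0"
    and "\<And>t \<tau>. prob_space.expectation M (\<lambda>\<omega>. X (t + \<tau>) \<omega> * X t \<omega>) = \<rho> \<tau>"
    and "continuous_on UNIV \<rho>"
    and "C_const p T A \<rho> > 0"
    and "\<epsilon> \<ge> (p / sqrt 2 + sqrt ((p / 2 + 1) * p)) powr p * C_const p T A \<rho>"
  shows "measure M {\<omega> \<in> space M.
            (\<integral>\<^sup>+\<tau>\<in>{0..A}. ennreal (\<bar>correlogram T X \<tau> \<omega> - \<rho> \<tau>\<bar> powr p) \<partial>lborel) > ennreal \<epsilon>}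
         \<le> 2 * sqrt (1 + sqrt 2 * \<epsilon> powr (1 / p) / C_const p T A \<rho> powr (1 / p))
             * exp (- (\<epsilon> powr (1 / p) / (sqrt 2 * C_const p T A \<rho> powr (1 / p))))"
proof -
  interpret stationary_gaussian M X \<rho>
    using assms(1,5,7-10) by (simp add: stationary_gaussian_def stationary_gaussian_axioms_def)
  show ?thesis by (rule correlogram_deviation) fact+
qed

end
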